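(* Let $l$ be one of the modal logics obtained from $\mathbf{K}$ by adding some (possibly none) of the axioms $D,T,4,5$, and suppose $l$ has a nontrivial completeness problem. Let $C$ be a complexity class. If $l$-provability (given a modal formula $\varphi$, decide whether $\vdash_l\varphi$) is $C$-hard, then the completeness problem for $l$ (given a modal formula $\varphi$, decide whether $\varphi$ is complete for $l$) is $C$-hard.
   Context: Modal formulas are generated by $\varphi ::= \bot \mid \top \mid p \mid \neg p \mid \varphi\wedge\varphi \mid \varphi\vee\varphi \mid \Box\varphi \mid \Diamond\varphi$, with $p$ ranging over a countably infinite set of propositional variables. Negation of arbitrary formulas, $\rightarrow$ and $\leftrightarrow$ are defined as usual. $P(\varphi)$ is the set of propositional variables appearing in $\varphi$, and $L(P)$ is the set of formulas using only variables from $P$. $\mathbf{K}$ is the smallest normal modal logic. Further axioms: $D:\Diamond\top$; $T:\Box\varphi\rightarrow\varphi$; $4:\Box\varphi\rightarrow\Box\Box\varphi$; $5:\Diamond\varphi\rightarrow\Box\Diamond\varphi$. $\vdash_l$ denotes derivability in $l$, which equals validity in all finite Kripke models for $l$, i.e. those whose accessibility relation is serial (if $l$ has $D$), reflexive ($T$), transitive ($4$), euclidean ($5$: $aRb$ and $aRc$ imply $bRc$). A formula is satisfiable for $l$ if it is true at some state of some model for $l$. A formula $\varphi$ is complete for $l$ if for every $\psi\in L(P(\varphi))$, $\vdash_l\varphi\rightarrow\psi$ or $\vdash_l\varphi\rightarrow\neg\psi$. The logic $l$ has a nontrivial completeness problem if, for finite nonempty sets $P$ of propositional variables, there are formulas $\varphi$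 with $P(\varphi)=P$ that are satisfiable and complete for $l$ (among the logics considered, exactly $\mathbf{D}=\mathbf{K}+D$ and $\mathbf{T}=\mathbf{K}+T$ fail this). $C$-hardness is with respect to polynomial-time (many-one) reductions. *)

theory Defs
  imports "HOL-Computational_Algebra.Polynomial"
begin

section \<open>Modal formulas\<close>

datatype fm =
    Bot | Top
  | Var nat | NVar nat
  | And fm fm | Or fm fm
  | Box fm | Dia fm

text \<open>In the grammar, negation is applied to variables only (\<open>NVar p\<close> is the literal
  \<open>\<not>p\<close>); negation of arbitrary formulas is the usual dualisation. In particular
  \<open>neg (Box (neg \<phi>))\<close> is literally \<open>Dia \<phi>\<close>, so that no duality axiom for the diamond is
  needed below.\<close>

primrec neg :: "fm \<Rightarrow> fm" where
  "neg Bot = Top"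
| "neg Top = Bot"
| "neg (Var p) = NVar p"
| "neg (NVar p) = Var p"
| "neg (And \<phi> \<psi>) = Or (neg \<phi>) (neg \<psi>)"
| "neg (Or \<phi> \<psi>) = And (neg \<phi>) (neg \<psi>)"
| "neg (Box \<phi>) = Dia (neg \<phi>)"
| "neg (Dia \<phi>) = Box (neg \<phi>)"

definition imp :: "fm \<Rightarrow> fm \<Rightarrow> fm" where
  "imp \<phi> \<psi> = Or (neg \<phi>) \<psi>"

primrec vars :: "fm \<Rightarrow> nat set" where
  "vars Bot = {}"
| "vars Top = {}"
| "vars (Var p) = {p}"
| "vars (NVar p) = {p}"
| "vars (And \<phi> \<psi>) = vars \<phi> \<union> vars \<psi>"
| "vars (Or \<phi> \<psi>) = vars \<phi> \<union> vars \<psi>"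
| "vars (Box \<phi>) = vars \<phi>"
| "vars (Dia \<phi>) = vars \<phi>"

lemma neg_neg [simp]: "neg (neg \<phi>) = \<phi>"
  by (induction \<phi>) simp_all

lemma vars_neg [simp]: "vars (neg \<phi>) = vars \<phi>"
  by (induction \<phi>) simp_all

section \<open>The logics and derivability\<close>

text \<open>A logic is given by the set of axioms that are added to \<open>K\<close>.\<close>

datatype axiom_name = AxD | AxT | Ax4 | Ax5

type_synonym modal_logic = "axiom_name set"

text \<open>Propositional truth under an assignment \<open>v\<close> of truth values to the variables and an
  assignment \<open>b\<close> of arbitrary truth values to the boxed formulas \<open>Box \<phi>\<close>; the value of
  \<open>Dia \<phi>\<close>, being the negation of \<open>Box (neg \<phi>)\<close>, is then determined.\<close>

primrec prop_val :: "(nat \<Rightarrow> bool) \<Rightarrow> (fm \<Rightarrow> bool) \<Rightarrow> fm \<Rightarrow> bool" where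
  "prop_val v b Bot \<longleftrightarrow> False"
| "prop_val v b Top \<longleftrightarrow> True"
| "prop_val v b (Var p) \<longleftrightarrow> v p"
| "prop_val v b (NVar p) \<longleftrightarrow> \<not> v p"
| "prop_val v b (And \<phi> \<psi>) \<longleftrightarrow> prop_val v b \<phi> \<and> prop_val v b \<psi>"
| "prop_val v b (Or \<phi> \<psi>) \<longleftrightarrow> prop_val v b \<phi> \<or> prop_val v b \<psi>"
| "prop_val v b (Box \<phi>) \<longleftrightarrow> b \<phi>"
| "prop_val v b (Dia \<phi>) \<longleftrightarrow> \<not> b (neg \<phi>)"

definition tautology :: "fm \<Rightarrow> bool" where
  "tautology \<phi> \<longleftrightarrow> (\<forall>v b. prop_val v b \<phi>)"

text \<open>The smallest normal modal logic containing the axioms in \<open>l\<close>. Closure under uniform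
  substitution is built in by taking all substitution instances of tautologies and axioms.\<close>

inductive derivable :: "modal_logic \<Rightarrow> fm \<Rightarrow> bool" (infix "\<turnstile>" 50) for l :: modal_logic where
  Taut: "tautology \<phi> \<Longrightarrow> l \<turnstile> \<phi>"
| K: "l \<turnstile> imp (Box (imp \<phi> \<psi>)) (imp (Box \<phi>) (Box \<psi>))"
| D: "AxD \<in> l \<Longrightarrow> l \<turnstile> Dia Top"
| T: "AxT \<in> l \<Longrightarrow> l \<turnstile> imp (Box \<phi>) \<phi>"
| Four: "Ax4 \<in> l \<Longrightarrow> l \<turnstile> imp (Box \<phi>) (Box (Box \<phi>))"
| Five: "Ax5 \<in> l \<Longrightarrow> l \<turnstile> imp (Dia \<phi>) (Box (Dia \<phi>))"
| MP: "l \<turnstile> imp \<phi> \<psi> \<Longrightarrow> l \<turnstile> \<phi> \<Longrightarrow> l \<turnstile> \<psi>"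
| Nec: "l \<turnstile> \<phi> \<Longrightarrow> l \<turnstile> Box \<phi>"

section \<open>Finite Kripke models and satisfiability\<close>

primrec holds_at :: "nat set \<Rightarrow> (nat \<times> nat) set \<Rightarrow> (nat \<Rightarrow> nat \<Rightarrow> bool) \<Rightarrow> nat \<Rightarrow> fm \<Rightarrow> bool" where
  "holds_at W R V a Bot \<longleftrightarrow> False"
| "holds_at W R V a Top \<longleftrightarrow> True"
| "holds_at W R V a (Var p) \<longleftrightarrow> V a p"
| "holds_at W R V a (NVar p) \<longleftrightarrow> \<not> V a p"
| "holds_at W R V a (And \<phi> \<psi>) \<longleftrightarrow> holds_at W R V a \<phi> \<and> holds_at W R V a \<psi>"
| "holds_at W R V a (Or \<phi> \<psi>) \<longleftrightarrow> holds_at W R V a \<phi> \<or> holds_at W R V a \<psi>"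
| "holds_at W R V a (Box \<phi>) \<longleftrightarrow> (\<forall>b\<in>W. (a, b) \<in> R \<longrightarrow> holds_at W R V b \<phi>)"
| "holds_at W R V a (Dia \<phi>) \<longleftrightarrow> (\<exists>b\<in>W. (a, b) \<in> R \<and> holds_at W R V b \<phi>)"

text \<open>Since the models are finite, up to isomorphism their states may be taken to be natural
  numbers.\<close>

definition finite_frame_for :: "modal_logic \<Rightarrow> nat set \<Rightarrow> (nat \<times> nat) set \<Rightarrow> bool" where
  "finite_frame_for l W R \<longleftrightarrow>
     finite W \<and> W \<noteq> {} \<and> R \<subseteq> W \<times> W \<and>
     (AxD \<in> l \<longrightarrow> (\<forall>a\<in>W. \<exists>b\<in>W. (a, b) \<in> R)) \<and>
     (AxT \<in> l \<longrightarrow> refl_on W R) \<and>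
     (Ax4 \<in> l \<longrightarrow> trans R) \<and>
     (Ax5 \<in> l \<longrightarrow> (\<forall>a b c. (a, b) \<in> R \<and> (a, c) \<in> R \<longrightarrow> (b, c) \<in> R))"

definition satisfiable :: "modal_logic \<Rightarrow> fm \<Rightarrow> bool" where
  "satisfiable l \<phi> \<longleftrightarrow>
     (\<exists>W R V. finite_frame_for l W R \<and> (\<exists>a\<in>W. holds_at W R V a \<phi>))"

section \<open>Completeness of formulas\<close>

definition complete_for :: "modal_logic \<Rightarrow> fm \<Rightarrow> bool" where
  "complete_for l \<phi> \<longleftrightarrow>
     (\<forall>\<psi>. vars \<psi> \<subseteq> vars \<phi> \<longrightarrow> l \<turnstile> imp \<phi> \<psi> \<or> l \<turnstile> imp \<phi> (neg \<psi>))"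

definition nontrivial_completeness_problem :: "modal_logic \<Rightarrow> bool" where
  "nontrivial_completeness_problem l \<longleftrightarrow>
     (\<forall>P. finite P \<and> P \<noteq> {} \<longrightarrow>
        (\<exists>\<phi>. vars \<phi> = P \<and> satisfiable l \<phi> \<and> complete_for l \<phi>))"

section \<open>Polynomial-time computable functions\<close>

text \<open>Deterministic Turing machines with several two-way infinite tapes. States and tape
  symbols are (bounded) natural numbers; \<open>0\<close> is the initial state, \<open>nstates M\<close> is the halting
  state, and \<open>0\<close> is the blank symbol. \<open>delta M q ss\<close> yields the next state and, for each tape,
  the symbol to be written and the head movement to be made after that, where \<open>ss\<close> lists
  the symbols currently scanned.\<close>

record tm =
  ntapes :: nat
  nstates :: nat
  nsyms :: nat
  delta :: "nat \<Rightarrow> nat list \<Rightarrow> nat \<times> (nat \<times> int) list"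

definition wf_tm :: "tm \<Rightarrow> bool" where
  "wf_tm M \<longleftrightarrow>
     1 \<le> ntapes M \<and> 3 \<le> nsyms M \<and>
     (\<forall>q < nstates M. \<forall>ss. length ss = ntapes M \<and> set ss \<subseteq> {..<nsyms M} \<longrightarrow>
        (case delta M q ss of (q', acts) \<Rightarrow>
           q' \<le> nstates M \<and> length acts = ntapes M \<and>
           (\<forall>(x, d) \<in> set acts. x < nsyms M \<and> d \<in> {-1, 0, 1})))"

text \<open>Cells are addressed relative to the head, which always scans cell \<open>0\<close>; moving the head
  shifts the tape.\<close>

type_synonym tape = "int \<Rightarrow> nat"

fun act :: "nat \<times> int \<Rightarrow> tape \<Rightarrow> tape" where
  "act (x, d) t = (\<lambda>i. (t(0 := x)) (i + d))"

fun step :: "tm \<Rightarrow> nat \<times> tape list \<Rightarrow> nat \<times> tape list" where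
  "step M (q, ts) =
     (if q < nstates M
      then (case delta M q (map (\<lambda>t. t 0) ts) of (q', acts) \<Rightarrow> (q', map2 act acts ts))
      else (q, ts))"

definition bit_sym :: "bool \<Rightarrow> nat" where
  "bit_sym x = (if x then 2 else 1)"

definition blank_tape :: tape where
  "blank_tape = (\<lambda>_. 0)"

definition input_tape :: "bool list \<Rightarrow> tape" where
  "input_tape w = (\<lambda>i. if 0 \<le> i \<and> i < int (length w) then bit_sym (w ! nat i) else 0)"

definition initial :: "tm \<Rightarrow> bool list \<Rightarrow> nat \<times> tape list" where
  "initial M w = (0, input_tape w # replicate (ntapes M - 1) blank_tape)"

text \<open>The output is the word on the last tape that starts at the scanned cell and extends to the
  right up to the first blank.\<close>

definition shows_word :: "tape \<Rightarrow> bool list \<Rightarrow> bool" where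
  "shows_word t w \<longleftrightarrow>
     (\<forall>i < length w. t (int i) = bit_sym (w ! i)) \<and> t (int (length w)) = 0"

definition polytime :: "(bool list \<Rightarrow> bool list) \<Rightarrow> bool" where
  "polytime f \<longleftrightarrow>
     (\<exists>M (p :: nat poly). wf_tm M \<and>
        (\<forall>w. \<exists>n \<le> poly p (length w). \<exists>ts.
           (step M ^^ n) (initial M w) = (nstates M, ts) \<and> shows_word (last ts) (f w)))"

section \<open>Encoding of formulas and hardness\<close>

text \<open>Variable indices are written in binary (least significant bit first); each bit is preceded
  by \<open>True\<close> and the end is marked by \<open>False\<close>. Formulas are written in prefix notation.\<close>

fun enc_nat :: "nat \<Rightarrow> bool list" where
  "enc_nat n = (if n = 0 then [False] else True # odd n # enc_nat (n div 2))"

declare enc_nat.simps [simp del]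

primrec enc_fm :: "fm \<Rightarrow> bool list" where
  "enc_fm Bot = [False, False, False]"
| "enc_fm Top = [False, False, True]"
| "enc_fm (Var p) = [False, True, False] @ enc_nat p"
| "enc_fm (NVar p) = [False, True, True] @ enc_nat p"
| "enc_fm (And \<phi> \<psi>) = [True, False, False] @ enc_fm \<phi> @ enc_fm \<psi>"
| "enc_fm (Or \<phi> \<psi>) = [True, False, True] @ enc_fm \<phi> @ enc_fm \<psi>"
| "enc_fm (Box \<phi>) = [True, True, False] @ enc_fm \<phi>"
| "enc_fm (Dia \<phi>) = [True, True, True] @ enc_fm \<phi>"

lemma enc_nat_0 [simp]: "enc_nat 0 = [False]"
  by (subst enc_nat.simps) simp

lemma enc_nat_pos: "0 < n \<Longrightarrow> enc_nat n = True # odd n # enc_nat (n div 2)"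
  by (subst enc_nat.simps) simp

lemma enc_nat_append_inject: "enc_nat m @ u = enc_nat n @ v \<Longrightarrow> m = n \<and> u = v"
proof (induction m arbitrary: n rule: less_induct)
  case (less m)
  show ?case
  proof (cases "m = 0 \<or> n = 0")
    case True
    with less.prems show ?thesis
      by (cases "m = 0"; cases "n = 0") (simp_all add: enc_nat_pos)
  next
    case False
    with less.prems have *: "odd m = odd n" "enc_nat (m div 2) @ u = enc_nat (n div 2) @ v"
      by (simp_all add: enc_nat_pos)
    have "m div 2 < m"
      using False by simp
    from less.IH[OF this *(2)] have "m div 2 = n div 2" "u = v"
      by simp_all
    moreover have "m mod 2 = n mod 2"
      using *(1) by (simp add: mod2_eq_if)
    ultimately show ?thesis
      by (metis div_mult_mod_eq)
  qed
qed

lemma enc_fm_append_inject: "enc_fm \<phi> @ u = enc_fm \<psi> @ v \<Longrightarrow> \<phi> = \<psi> \<and> u = v"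
proof (induction \<phi> arbitrary: \<psi> u v)
  case (And \<phi>1 \<phi>2)
  from And.prems obtain \<psi>1 \<psi>2 where \<psi>: "\<psi> = And \<psi>1 \<psi>2"
    by (cases \<psi>) simp_all
  with And.prems have "enc_fm \<phi>1 @ enc_fm \<phi>2 @ u = enc_fm \<psi>1 @ enc_fm \<psi>2 @ v"
    by simp
  with And.IH(1) have "\<phi>1 = \<psi>1" "enc_fm \<phi>2 @ u = enc_fm \<psi>2 @ v"
    by blast+
  with And.IH(2) \<psi> show ?case
    by blast
next
  case (Or \<phi>1 \<phi>2)
  from Or.prems obtain \<psi>1 \<psi>2 where \<psi>: "\<psi> = Or \<psi>1 \<psi>2"
    by (cases \<psi>) simp_all
  with Or.prems have "enc_fm \<phi>1 @ enc_fm \<phi>2 @ u = enc_fm \<psi>1 @ enc_fm \<psi>2 @ v"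
    by simp
  with Or.IH(1) have "\<phi>1 = \<psi>1" "enc_fm \<phi>2 @ u = enc_fm \<psi>2 @ v"
    by blast+
  with Or.IH(2) \<psi> show ?case
    by blast
next
  case (Var p)
  from Var.prems obtain q where \<psi>: "\<psi> = Var q" and "enc_nat p @ u = enc_nat q @ v"
    by (cases \<psi>) simp_all
  with enc_nat_append_inject show ?case
    by blast
next
  case (NVar p)
  from NVar.prems obtain q where \<psi>: "\<psi> = NVar q" and "enc_nat p @ u = enc_nat q @ v"
    by (cases \<psi>) simp_all
  with enc_nat_append_inject show ?case
    by blast
next
  case (Box \<phi>)
  from Box.prems obtain \<psi>' where "\<psi> = Box \<psi>'" and "enc_fm \<phi> @ u = enc_fm \<psi>' @ v"
    by (cases \<psi>) simp_all
  with Box.IH show ?case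
    by blast
next
  case (Dia \<phi>)
  from Dia.prems obtain \<psi>' where "\<psi> = Dia \<psi>'" and "enc_fm \<phi> @ u = enc_fm \<psi>' @ v"
    by (cases \<psi>) simp_all
  with Dia.IH show ?case
    by blast
next
  case Bot
  then show ?case by (cases \<psi>) simp_all
next
  case Top
  then show ?case by (cases \<psi>) simp_all
qed

lemma inj_enc_fm: "inj enc_fm"
proof (rule injI)
  fix \<phi> \<psi> assume "enc_fm \<phi> = enc_fm \<psi>"
  then have "enc_fm \<phi> @ [] = enc_fm \<psi> @ []"
    by simp
  then show "\<phi> = \<psi>"
    using enc_fm_append_inject by blast
qed

text \<open>A complexity class is a set of languages of binary words. A decision problem whose instances
  are formulas is given by the set of its yes-instances; a many-one reduction of a language
  to it maps words to (encodings of) formulas.\<close>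

definition polytime_reducible :: "bool list set \<Rightarrow> fm set \<Rightarrow> bool" where
  "polytime_reducible A X \<longleftrightarrow>
     (\<exists>f :: bool list \<Rightarrow> fm. polytime (\<lambda>w. enc_fm (f w)) \<and> (\<forall>w. w \<in> A \<longleftrightarrow> f w \<in> X))"

definition hard_for :: "bool list set set \<Rightarrow> fm set \<Rightarrow> bool" where
  "hard_for C X \<longleftrightarrow> (\<forall>A \<in> C. polytime_reducible A X)"

definition provability_problem :: "modal_logic \<Rightarrow> fm set" where
  "provability_problem l = {\<phi>. l \<turnstile> \<phi>}"

definition completeness_problem :: "modal_logic \<Rightarrow> fm set" where
  "completeness_problem l = {\<phi>. complete_for l \<phi>}"

end

theory Submission
  imports Defs
begin

text \<open>The reduction maps \<open>\<phi>\<close> to \<open>(\<not>\<phi>' \<and> \<not>q) \<or> \<chi>\<close>, where \<open>\<phi>'\<close> is \<open>\<phi>\<close> with its variables renamed apart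
  from \<open>q\<close>, and \<open>\<chi>\<close> is a satisfiable complete formula in the variables of \<open>\<phi>'\<close> and \<open>q\<close> that entails
  \<open>q\<close>. If \<open>\<phi>\<close> is provable, then the result is equivalent to \<open>\<chi>\<close>, hence complete. If not, then both
  disjuncts are satisfiable, and \<open>q\<close> is left undecided. Owing to the fresh variable \<open>q\<close>, the
  model of \<open>\<chi>\<close> never has to be checked against \<open>\<phi>\<close>.

  The formula \<open>\<chi>\<close> describes one point where all variables are true: without successors if neither
  \<open>D\<close> nor \<open>T\<close> is present, and reflexive otherwise. In the second case \<open>\<chi>\<close> is complete in the presence
  of \<open>4\<close> or \<open>5\<close>; without them, no formula with variables is satisfiable and complete,
  because the model can be unravelled and changed beyond the modal depth of the formula.

  In prefix notation, all parts of the result that depend on \<open>\<phi>\<close> arise from the code of \<open>\<phi>\<close> by replacing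
  it token by token. So a machine that produces \<open>\<phi>\<close> only has to be followed by finitely many
  passes of a finite-state transducer over its output.\<close>

section \<open>Propositional reasoning in the calculus\<close>

section \<open>Derivability\<close>

lemma prop_val_neg [simp]: "prop_val v b (neg \<phi>) \<longleftrightarrow> \<not> prop_val v b \<phi>"
  by (induction \<phi>) simp_all

lemma prop_val_imp [simp]: "prop_val v b (imp \<phi> \<psi>) \<longleftrightarrow> (prop_val v b \<phi> \<longrightarrow> prop_val v b \<psi>)"
  by (simp add: imp_def)

text \<open>Propositional steps are checked semantically: \<open>prop_val\<close> treats boxed
  formulas as atoms, so a consequence valid for all \<open>v\<close> and \<open>b\<close> is a
  tautology followed by \<open>MP\<close>.\<close>

lemma derivable_conseq:
  assumes "l \<turnstile> \<phi>" "\<And>v b. prop_val v b \<phi> \<Longrightarrow> prop_val v b \<psi>"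
  shows "l \<turnstile> \<psi>"
  using assms by (intro MP[OF Taut assms(1)]) (simp add: tautology_def)

lemma derivable_conseq2:
  assumes "l \<turnstile> \<phi>" "l \<turnstile> \<chi>"
    and "\<And>v b. prop_val v b \<phi> \<Longrightarrow> prop_val v b \<chi> \<Longrightarrow> prop_val v b \<psi>"
  shows "l \<turnstile> \<psi>"
  using assms by (intro MP[OF derivable_conseq[OF assms(1)] assms(2)]) simp

lemma imp_trans:
  assumes "l \<turnstile> imp \<phi> \<chi>" "l \<turnstile> imp \<chi> \<psi>"
  shows "l \<turnstile> imp \<phi> \<psi>"
  by (rule derivable_conseq2[OF assms]) simp

lemma box_mono:
  assumes "l \<turnstile> imp \<phi> \<psi>"
  shows "l \<turnstile> imp (Box \<phi>) (Box \<psi>)"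
  using MP[OF derivable.K Nec[OF assms]] .

section \<open>Closure under uniform substitution\<close>

section \<open>Substitution\<close>

primrec subst :: "(nat \<Rightarrow> fm) \<Rightarrow> fm \<Rightarrow> fm" where
  "subst s Bot = Bot"
| "subst s Top = Top"
| "subst s (Var p) = s p"
| "subst s (NVar p) = neg (s p)"
| "subst s (And \<phi> \<psi>) = And (subst s \<phi>) (subst s \<psi>)"
| "subst s (Or \<phi> \<psi>) = Or (subst s \<phi>) (subst s \<psi>)"
| "subst s (Box \<phi>) = Box (subst s \<phi>)"
| "subst s (Dia \<phi>) = Dia (subst s \<phi>)"

lemma subst_neg [simp]: "subst s (neg \<phi>) = neg (subst s \<phi>)"
  by (induction \<phi>) simp_all

lemma subst_imp [simp]: "subst s (imp \<phi> \<psi>) = imp (subst s \<phi>) (subst s \<psi>)"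
  by (simp add: imp_def)

text \<open>A substitution also acts inside the boxed atoms, so their induced assignment is
  \<open>b\<close> precomposed with \<open>subst s\<close>. Hence instances of tautologies are
  tautologies.\<close>

lemma prop_val_subst:
  "prop_val v b (subst s \<phi>) \<longleftrightarrow>
     prop_val (\<lambda>p. prop_val v b (s p)) (\<lambda>\<chi>. b (subst s \<chi>)) \<phi>"
  by (induction \<phi>) simp_all

lemma derivable_subst: "l \<turnstile> \<phi> \<Longrightarrow> l \<turnstile> subst s \<phi>"
proof (induction rule: derivable.induct)
  case (Taut \<phi>)
  then show ?case
    by (intro derivable.Taut) (simp add: tautology_def prop_val_subst)
next
  case (MP \<phi> \<psi>)
  then show ?case by (auto intro: derivable.MP)
qed (auto intro: derivable.intros)

section \<open>Kripke semantics over arbitrary state types\<close>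

section \<open>Soundness\<close>

text \<open>The state type is left open so that models on pairs and on \<open>unit\<close> can be
  used without coding states as numbers. The frames considered have
  \<open>R \<subseteq> W \<times> W\<close>, so quantifying along \<open>R\<close> stays inside
  \<open>W\<close>.\<close>

primrec sem :: "('a \<times> 'a) set \<Rightarrow> ('a \<Rightarrow> nat \<Rightarrow> bool) \<Rightarrow> 'a \<Rightarrow> fm \<Rightarrow> bool" where
  "sem R V a Bot \<longleftrightarrow> False"
| "sem R V a Top \<longleftrightarrow> True"
| "sem R V a (Var p) \<longleftrightarrow> V a p"
| "sem R V a (NVar p) \<longleftrightarrow> \<not> V a p"
| "sem R V a (And \<phi> \<psi>) \<longleftrightarrow> sem R V a \<phi> \<and> sem R V a \<psi>"
| "sem R V a (Or \<phi> \<psi>) \<longleftrightarrow> sem R V a \<phi> \<or> sem R V a \<psi>"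
| "sem R V a (Box \<phi>) \<longleftrightarrow> (\<forall>b. (a, b) \<in> R \<longrightarrow> sem R V b \<phi>)"
| "sem R V a (Dia \<phi>) \<longleftrightarrow> (\<exists>b. (a, b) \<in> R \<and> sem R V b \<phi>)"

lemma sem_neg [simp]: "sem R V a (neg \<phi>) \<longleftrightarrow> \<not> sem R V a \<phi>"
  by (induction \<phi> arbitrary: a) simp_all

lemma sem_imp [simp]: "sem R V a (imp \<phi> \<psi>) \<longleftrightarrow> (sem R V a \<phi> \<longrightarrow> sem R V a \<psi>)"
  by (simp add: imp_def)

lemma holds_at_sem:
  assumes "R \<subseteq> W \<times> W"
  shows "holds_at W R V a \<phi> \<longleftrightarrow> sem R V a \<phi>"
  using assms by (induction \<phi> arbitrary: a) auto

text \<open>Taking the boxed formulas as atoms turns a state into a propositional assignment, which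
  makes tautologies sound.\<close>

lemma sem_prop_val: "sem R V a \<phi> \<longleftrightarrow> prop_val (V a) (\<lambda>\<chi>. sem R V a (Box \<chi>)) \<phi>"
  by (induction \<phi>) simp_all

definition frame_for :: "modal_logic \<Rightarrow> 'a set \<Rightarrow> ('a \<times> 'a) set \<Rightarrow> bool" where
  "frame_for l W R \<longleftrightarrow>
     R \<subseteq> W \<times> W \<and>
     (AxD \<in> l \<longrightarrow> (\<forall>a\<in>W. \<exists>b. (a, b) \<in> R)) \<and>
     (AxT \<in> l \<longrightarrow> (\<forall>a\<in>W. (a, a) \<in> R)) \<and>
     (Ax4 \<in> l \<longrightarrow> trans R) \<and>
     (Ax5 \<in> l \<longrightarrow> (\<forall>a b c. (a, b) \<in> R \<and> (a, c) \<in> R \<longrightarrow> (b, c) \<in> R))"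

lemma soundness:
  assumes "l \<turnstile> \<phi>" and frame: "frame_for l W R"
  shows "a \<in> W \<Longrightarrow> sem R V a \<phi>"
  using assms(1)
proof (induction arbitrary: a rule: derivable.induct)
  case (Taut \<phi>)
  then show ?case by (subst sem_prop_val) (simp add: tautology_def)
next
  case (Four \<phi>)
  then have "trans R" using frame by (simp add: frame_for_def)
  then show ?case by (auto dest: transD)
next
  case (Five \<phi>)
  then have "(b, c) \<in> R" if "(a, b) \<in> R" "(a, c) \<in> R" for b c
    using frame that unfolding frame_for_def by blast
  then show ?case by simp blast
next
  case (Nec \<phi>)
  have "R \<subseteq> W \<times> W" using frame by (simp add: frame_for_def)
  with Nec show ?case by auto
next
  case D
  then show ?case using frame by (simp add: frame_for_def)
next
  case (T \<phi>)
  then have "(a, a) \<in> R" using frame by (simp add: frame_for_def)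
  then show ?case by simp
qed simp_all

section \<open>No satisfiable complete formulas for \<open>D\<close> or \<open>T\<close> without
  \<open>4\<close> and \<open>5\<close>\<close>

section \<open>Logics with a trivial completeness problem\<close>

primrec depth :: "fm \<Rightarrow> nat" where
  "depth Bot = 0"
| "depth Top = 0"
| "depth (Var p) = 0"
| "depth (NVar p) = 0"
| "depth (And \<phi> \<psi>) = max (depth \<phi>) (depth \<psi>)"
| "depth (Or \<phi> \<psi>) = max (depth \<phi>) (depth \<psi>)"
| "depth (Box \<phi>) = Suc (depth \<phi>)"
| "depth (Dia \<phi>) = Suc (depth \<phi>)"

text \<open>The model is stacked in levels \<open>0\<close> to \<open>N\<close>, recording only the
  height of a path. Loops at the top keep the frame serial; with \<open>r\<close>, loops everywhere
  keep it reflexive.\<close>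

definition unravel :: "bool \<Rightarrow> nat \<Rightarrow> ('a \<times> 'a) set \<Rightarrow> 'a set \<Rightarrow> (('a \<times> nat) \<times> ('a \<times> nat)) set" where
  "unravel r N R W =
     {((a, i), (b, Suc i)) | a b i. (a, b) \<in> R \<and> i < N} \<union>
     {((a, i), (a, i)) | a i. a \<in> W \<and> i \<le> N \<and> (i = N \<or> r)}"

text \<open>The parity pattern above level \<open>d\<close> makes the height of the model visible to
  formulas of sufficient depth.\<close>

definition level_val :: "nat \<Rightarrow> ('a \<Rightarrow> nat \<Rightarrow> bool) \<Rightarrow> 'a \<times> nat \<Rightarrow> nat \<Rightarrow> bool" where
  "level_val d V = (\<lambda>(a, i) p. if i \<le> d then V a p else even i)"

lemma unravel_iff:
  "((a, i), (b, j)) \<in> unravel r N R W \<longleftrightarrow>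
     (a, b) \<in> R \<and> j = Suc i \<and> i < N \<or> a = b \<and> i = j \<and> a \<in> W \<and> i \<le> N \<and> (i = N \<or> r)"
  by (auto simp: unravel_def)

lemma frame_unravel:
  assumes "frame_for l W R" "AxD \<in> l \<or> AxT \<in> l" and n45: "Ax4 \<notin> l" "Ax5 \<notin> l"
  shows "frame_for l (W \<times> {..N}) (unravel (AxT \<in> l) N R W)"
proof -
  have "\<exists>y. ((a, i), y) \<in> unravel (AxT \<in> l) N R W" if "a \<in> W" "i \<le> N" for a i
  proof (cases "i = N")
    case True
    then have "((a, i), (a, i)) \<in> unravel (AxT \<in> l) N R W"
      using that by (simp add: unravel_iff)
    then show ?thesis ..
  next
    case False
    obtain b where "(a, b) \<in> R"
      using assms \<open>a \<in> W\<close> by (auto simp: frame_for_def)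
    then have "((a, i), (b, Suc i)) \<in> unravel (AxT \<in> l) N R W"
      using that False by (simp add: unravel_iff)
    then show ?thesis ..
  qed
  moreover have "R \<subseteq> W \<times> W"
    using assms(1) by (simp add: frame_for_def)
  then have "unravel (AxT \<in> l) N R W \<subseteq> (W \<times> {..N}) \<times> (W \<times> {..N})"
    unfolding unravel_def by auto
  ultimately show ?thesis
    using n45 by (auto simp: frame_for_def unravel_iff)
qed

text \<open>A formula of depth \<open>k\<close> at level \<open>i\<close> looks no further than
  level \<open>i + k\<close>, where the valuation is the original one. A loop met below the top
  comes from \<open>r\<close>, and then the original frame has it as well.\<close>

lemma sem_unravel:
  assumes "R \<subseteq> W \<times> W" "r \<longrightarrow> (\<forall>a\<in>W. (a, a) \<in> R)" "d \<le> N"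
  shows "a \<in> W \<Longrightarrow> i + depth \<phi> \<le> d \<Longrightarrow>
    sem (unravel r N R W) (level_val d V) (a, i) \<phi> \<longleftrightarrow> sem R V a \<phi>"
proof (induction \<phi> arbitrary: a i)
  case (Box \<phi>)
  have "sem (unravel r N R W) (level_val d V) (b, Suc i) \<phi> \<longleftrightarrow> sem R V b \<phi>" if "(a, b) \<in> R" for b
    using that Box assms by auto
  moreover have "sem (unravel r N R W) (level_val d V) (a, i) \<phi> \<longleftrightarrow> sem R V a \<phi>"
    using Box by auto
  ultimately show ?case
    using Box.prems assms by (auto simp: unravel_iff)
next
  case (Dia \<phi>)
  have "sem (unravel r N R W) (level_val d V) (b, Suc i) \<phi> \<longleftrightarrow> sem R V b \<phi>" if "(a, b) \<in> R" for b
    using that Dia assms by auto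
  moreover have "sem (unravel r N R W) (level_val d V) (a, i) \<phi> \<longleftrightarrow> sem R V a \<phi>"
    using Dia by auto
  ultimately show ?case
    using Dia.prems assms by (auto simp: unravel_iff)
qed (simp_all add: level_val_def)

definition lit :: "bool \<Rightarrow> fm" where
  "lit q = (if q then Var 0 else NVar 0)"

lemma sem_lit [simp]: "sem R V a (lit q) \<longleftrightarrow> V a 0 = q"
  by (simp add: lit_def)

text \<open>Measures height: in an unravelled model, a path that flips variable \<open>0\<close> at
  every step has to climb at every step.\<close>

primrec alternating :: "bool \<Rightarrow> nat \<Rightarrow> fm" where
  "alternating q 0 = lit q"
| "alternating q (Suc k) = And (lit q) (Dia (alternating (\<not> q) k))"

lemma vars_alternating [simp]: "vars (alternating q k) = {0}"
  by (induction k arbitrary: q) (simp_all add: lit_def)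

lemma vars_Dia_pow [simp]: "vars ((Dia ^^ k) \<phi>) = vars \<phi>"
  by (induction k) simp_all

lemma alternating_lit: "sem R V a (alternating q k) \<Longrightarrow> V a 0 = q"
  by (cases k) auto

text \<open>A step in the unravelled model that changes the truth value of a variable has to go up
  one level.\<close>

lemma alternating_le:
  "sem (unravel r N R W) V (a, i) (alternating q k) \<Longrightarrow> i \<le> N \<Longrightarrow> i + k \<le> N"
proof (induction k arbitrary: a i q)
  case (Suc k)
  then obtain b j where *: "((a, i), (b, j)) \<in> unravel r N R W"
      "sem (unravel r N R W) V (b, j) (alternating (\<not> q) k)" "V (a, i) 0 = q"
    by auto
  moreover from *(2) have "V (b, j) 0 = (\<not> q)"
    by (rule alternating_lit)
  ultimately have "j = Suc i" "i < N"
    by (auto simp: unravel_iff)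
  then show ?case
    using Suc.IH[OF *(2)] by simp
qed simp

lemma not_Dia_pow_alternating:
  assumes "N < k"
  shows "i \<le> N \<Longrightarrow> \<not> sem (unravel r N R W) V (a, i) ((Dia ^^ m) (alternating q k))"
proof (induction m arbitrary: a i)
  case 0
  then show ?case using alternating_le assms by fastforce
next
  case (Suc m)
  have "j \<le> N" if "((a, i), (b, j)) \<in> unravel r N R W" for b j
    using that by (auto simp: unravel_iff)
  with Suc.IH show ?case by auto
qed

text \<open>Above level \<open>d\<close>, each climb changes the parity and with it the variable, so
  seriality alone yields the alternating path.\<close>

lemma alternating_level_val:
  assumes "\<forall>a\<in>W. \<exists>b\<in>W. (a, b) \<in> R"
  shows "a \<in> W \<Longrightarrow> d < i \<Longrightarrow> i + k \<le> N \<Longrightarrow>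
    sem (unravel r N R W) (level_val d V) (a, i) (alternating (even i) k)"
proof (induction k arbitrary: a i)
  case 0
  then show ?case by (simp add: level_val_def)
next
  case (Suc k)
  then obtain b where "b \<in> W" "(a, b) \<in> R" using assms by blast
  moreover have "sem (unravel r N R W) (level_val d V) (b, Suc i) (alternating (even (Suc i)) k)"
    using Suc.prems by (intro Suc.IH \<open>b \<in> W\<close>) auto
  moreover have "((a, i), (b, Suc i)) \<in> unravel r N R W"
    using Suc.prems \<open>(a, b) \<in> R\<close> by (simp add: unravel_iff)
  moreover have "level_val d V (a, i) 0 = even i"
    using Suc.prems by (simp add: level_val_def)
  ultimately show ?case
    by auto
qed

lemma Dia_pow_level:
  assumes "\<forall>a\<in>W. \<exists>b\<in>W. (a, b) \<in> R"
    and "\<And>b. b \<in> W \<Longrightarrow> sem (unravel r N R W) V (b, i + m) \<phi>"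
  shows "a \<in> W \<Longrightarrow> i + m \<le> N \<Longrightarrow> sem (unravel r N R W) V (a, i) ((Dia ^^ m) \<phi>)"
  using assms(2)
proof (induction m arbitrary: a i)
  case (Suc m)
  then obtain b where "b \<in> W" "(a, b) \<in> R" using assms by blast
  moreover have "sem (unravel r N R W) V (b, Suc i) ((Dia ^^ m) \<phi>)"
    using Suc.prems by (intro Suc.IH \<open>b \<in> W\<close>) auto
  ultimately show ?case
    using Suc.prems by (auto simp: unravel_iff)
qed simp

lemma trivial_completeness_problem:
  assumes DT: "AxD \<in> l \<or> AxT \<in> l" and n45: "Ax4 \<notin> l" "Ax5 \<notin> l"
  shows "\<not> nontrivial_completeness_problem l"
proof
  assume "nontrivial_completeness_problem l"
  then have "\<exists>\<phi>. vars \<phi> = {0} \<and> satisfiable l \<phi> \<and> complete_for l \<phi>"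
    unfolding nontrivial_completeness_problem_def by (elim allE[of _ "{0}"]) simp
  then obtain \<phi> where \<phi>: "vars \<phi> = {0}" "satisfiable l \<phi>" "complete_for l \<phi>"
    by blast
  from \<phi>(2) obtain W R V a where fin: "finite_frame_for l W R"
    and a: "a \<in> W" "holds_at W R V a \<phi>"
    unfolding satisfiable_def by blast
  have frame: "frame_for l W R"
    using fin unfolding finite_frame_for_def frame_for_def refl_on_def by meson
  then have RW: "R \<subseteq> W \<times> W" by (simp add: frame_for_def)
  have sem: "sem R V a \<phi>"
    using a holds_at_sem[OF RW] by blast
  have serial: "\<forall>a\<in>W. \<exists>b\<in>W. (a, b) \<in> R"
    using frame DT unfolding frame_for_def by blast
  have T: "(AxT \<in> l) \<longrightarrow> (\<forall>a\<in>W. (a, a) \<in> R)"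
    using frame by (simp add: frame_for_def)
  define d where "d = depth \<phi>"
  \<comment> \<open>The formula asks for \<open>d + 1\<close> steps followed by \<open>d + 1\<close>
    flips. The model of height \<open>d\<close> is too low for the flips, while the one of height
    \<open>2 * (d + 1)\<close> has room for both; the parity is that of level \<open>d + 1\<close>.
    Both models satisfy \<open>\<phi>\<close> at \<open>(a, 0)\<close>, so \<open>\<phi>\<close>
    leaves \<open>\<psi>\<close> open.\<close>
  define \<psi> where "\<psi> = (Dia ^^ Suc d) (alternating (even (Suc d)) (Suc d))"
  define M where "M N = unravel (AxT \<in> l) N R W" for N
  have val: "sem (M N) (level_val d V) (a, 0) \<phi>" if "d \<le> N" for N
    using sem_unravel[OF RW T that, of a 0 \<phi>] a sem unfolding M_def d_def by simp
  have sound: "sem (M N) (level_val d V) (a, 0) \<chi>" if "l \<turnstile> \<chi>" for N \<chi>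
    using soundness[OF that frame_unravel[OF frame DT n45]] a(1) unfolding M_def by simp
  have "\<not> sem (M d) (level_val d V) (a, 0) \<psi>"
    unfolding M_def \<psi>_def by (intro not_Dia_pow_alternating) auto
  then have "\<not> l \<turnstile> imp \<phi> \<psi>"
    using sound[of "imp \<phi> \<psi>" d] val[of d] by auto
  moreover have "sem (M (Suc d + Suc d)) (level_val d V) (a, 0) \<psi>"
    unfolding M_def \<psi>_def
    by (rule Dia_pow_level[OF serial _ a(1)], unfold add_0, rule alternating_level_val[OF serial]) auto
  then have "\<not> l \<turnstile> imp \<phi> (neg \<psi>)"
    using sound[of "imp \<phi> (neg \<psi>)" "Suc d + Suc d"] val[of "Suc d + Suc d"] by auto
  moreover have "vars \<psi> \<subseteq> vars \<phi>"
    using \<phi>(1) unfolding \<psi>_def vars_Dia_pow vars_alternating by simp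
  ultimately show False
    using \<phi>(3) unfolding complete_for_def by blast
qed

section \<open>The reduction and its vocabulary\<close>

section \<open>The reduction\<close>

text \<open>In the binary encoding, \<open>2 * p + 1\<close> arises from \<open>p\<close> by inserting two symbols, and \<open>0\<close> becomes
  fresh. The conjunction \<open>lits \<phi>\<close> keeps the shape of \<open>\<phi>\<close>, so that it can be produced by replacing
  tokens.\<close>

definition shift :: "fm \<Rightarrow> fm" where
  "shift = subst (\<lambda>p. Var (2 * p + 1))"

primrec lits :: "fm \<Rightarrow> fm" where
  "lits Bot = Top"
| "lits Top = Top"
| "lits (Var p) = Var (2 * p + 1)"
| "lits (NVar p) = Var (2 * p + 1)"
| "lits (And \<phi> \<psi>) = And (lits \<phi>) (lits \<psi>)"
| "lits (Or \<phi> \<psi>) = And (lits \<phi>) (lits \<psi>)"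
| "lits (Box \<phi>) = lits \<phi>"
| "lits (Dia \<phi>) = lits \<phi>"

definition all_true :: "fm \<Rightarrow> fm" where
  "all_true \<phi> = And (Var 0) (lits \<phi>)"

text \<open>With \<open>D\<close> and \<open>5\<close> alone, a state need not see all that its
  successors see, so one box would not reach far enough. From the second box on,
  \<open>derivable_Box_Box\<close> propagates \<open>all_true\<close>.\<close>

definition char_fm :: "modal_logic \<Rightarrow> fm \<Rightarrow> fm" where
  "char_fm l \<phi> =
     (if AxD \<in> l \<or> AxT \<in> l
      then And (all_true \<phi>) (And (Box (all_true \<phi>)) (Box (Box (all_true \<phi>))))
      else And (Box Bot) (all_true \<phi>))"

definition reduction :: "modal_logic \<Rightarrow> fm \<Rightarrow> fm" where
  "reduction l \<phi> = Or (And (neg (shift \<phi>)) (NVar 0)) (char_fm l \<phi>)"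

lemma vars_shift: "vars (shift \<phi>) = vars (lits \<phi>)"
  by (induction \<phi>) (simp_all add: shift_def)

text \<open>Completeness quantifies over the vocabulary of the formula itself, so
  \<open>char_fm\<close> must mention every variable of the reduction; this is why
  \<open>lits\<close> keeps all of them.\<close>

lemma vars_reduction: "vars (reduction l \<phi>) = vars (all_true \<phi>)"
  by (auto simp: reduction_def char_fm_def vars_shift all_true_def)

lemma prop_val_lits: "prop_val v b (lits \<phi>) \<longleftrightarrow> (\<forall>p\<in>vars (lits \<phi>). v p)"
  by (induction \<phi>) auto

lemma prop_val_all_true: "prop_val v b (all_true \<phi>) \<longleftrightarrow> (\<forall>p\<in>vars (all_true \<phi>). v p)"
  by (auto simp: all_true_def prop_val_lits)

section \<open>Completeness of the characteristic formula\<close>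

definition decides :: "modal_logic \<Rightarrow> fm \<Rightarrow> fm \<Rightarrow> bool" where
  "decides l \<phi> \<psi> \<longleftrightarrow> l \<turnstile> imp \<phi> \<psi> \<or> l \<turnstile> imp \<phi> (neg \<psi>)"

lemma decides_neg: "decides l \<phi> (neg \<psi>) \<longleftrightarrow> decides l \<phi> \<psi>"
  by (auto simp: decides_def)

lemma decidesI1: "l \<turnstile> imp \<phi> \<psi> \<Longrightarrow> decides l \<phi> \<psi>"
  and decidesI2: "l \<turnstile> imp \<phi> (neg \<psi>) \<Longrightarrow> decides l \<phi> \<psi>"
  by (auto simp: decides_def)

lemma decides_And:
  assumes "decides l \<phi> \<psi>1" "decides l \<phi> \<psi>2"
  shows "decides l \<phi> (And \<psi>1 \<psi>2)"
proof -
  consider "l \<turnstile> imp \<phi> (neg \<psi>1)" | "l \<turnstile> imp \<phi> (neg \<psi>2)" | "l \<turnstile> imp \<phi> \<psi>1" "l \<turnstile> imp \<phi> \<psi>2"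
    using assms by (auto simp: decides_def)
  then show ?thesis
  proof cases
    case 1
    show ?thesis by (rule decidesI2, rule derivable_conseq[OF 1]) auto
  next
    case 2
    show ?thesis by (rule decidesI2, rule derivable_conseq[OF 2]) auto
  next
    case 3
    show ?thesis by (rule decidesI1, rule derivable_conseq2[OF 3]) auto
  qed
qed

text \<open>Decided formulas are closed under negation and conjunction, hence under disjunction; the
  diamond is dual to the box. What remains is variables and boxes.\<close>

lemma decides_all:
  assumes var: "\<And>p. p \<in> P \<Longrightarrow> decides l \<phi> (Var p)"
    and box: "\<And>\<chi>. decides l \<phi> \<chi> \<Longrightarrow> decides l \<phi> (Box \<chi>)"
  shows "vars \<psi> \<subseteq> P \<Longrightarrow> decides l \<phi> \<psi>"
proof (induction \<psi>)
  case Bot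
  show ?case by (rule decidesI2, rule Taut) (simp add: tautology_def)
next
  case Top
  show ?case by (rule decidesI1, rule Taut) (simp add: tautology_def)
next
  case (Var p)
  then show ?case by (simp add: var)
next
  case (NVar p)
  then show ?case using decides_neg[of l \<phi> "Var p"] by (simp add: var)
next
  case (And \<psi>1 \<psi>2)
  then show ?case by (simp add: decides_And)
next
  case (Or \<psi>1 \<psi>2)
  then have "decides l \<phi> (neg (And (neg \<psi>1) (neg \<psi>2)))"
    unfolding decides_neg by (intro decides_And) (simp_all add: decides_neg)
  then show ?case by simp
next
  case (Box \<psi>)
  then show ?case by (simp add: box)
next
  case (Dia \<psi>)
  then have "decides l \<phi> (neg (Box (neg \<psi>)))"
    unfolding decides_neg by (intro box) (simp add: decides_neg)
  then show ?case by simp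
qed

lemma derivable_D:
  assumes "AxD \<in> l \<or> AxT \<in> l"
  shows "l \<turnstile> imp (Box \<phi>) (Dia \<phi>)"
proof -
  have "l \<turnstile> Dia Top"
  proof (cases "AxD \<in> l")
    case False
    \<comment> \<open>Read propositionally, this is \<open>Dia Top\<close>, since
      \<open>neg Top\<close> is \<open>Bot\<close>.\<close>
    then have "l \<turnstile> imp (Box Bot) Bot" using assms by (intro derivable.T) simp
    then show ?thesis by (rule derivable_conseq) simp
  qed (rule derivable.D)
  moreover have "l \<turnstile> imp (Box \<phi>) (imp (Box (neg \<phi>)) (Box Bot))"
  proof (rule imp_trans)
    show "l \<turnstile> imp (Box \<phi>) (Box (imp (neg \<phi>) Bot))"
      by (rule box_mono, rule Taut) (simp add: tautology_def)
  qed (rule derivable.K)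
  ultimately show ?thesis
    by (rule derivable_conseq2) auto
qed

text \<open>Under \<open>4\<close> this is an instance of the axiom. Under \<open>5\<close>,
  \<open>Dia (Box \<phi>)\<close> implies \<open>Box \<phi>\<close> by contraposition and also
  implies its own necessitation, so it implies any number of boxes; \<open>derivable_D\<close>
  supplies it from \<open>Box (Box \<phi>)\<close>.\<close>

lemma derivable_Box_Box:
  assumes "AxD \<in> l \<or> AxT \<in> l" "Ax4 \<in> l \<or> Ax5 \<in> l"
  shows "l \<turnstile> imp (Box (Box \<phi>)) (Box (Box (Box \<phi>)))"
proof (cases "Ax4 \<in> l")
  case True
  then show ?thesis by (rule derivable.Four)
next
  case False
  with assms have 5: "Ax5 \<in> l" by simp
  from derivable.Five[OF 5, of "neg \<phi>"] have "l \<turnstile> imp (Dia (Box \<phi>)) (Box \<phi>)"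
    by (rule derivable_conseq) auto
  from box_mono[OF this] have 1: "l \<turnstile> imp (Dia (Box \<phi>)) (Box (Box \<phi>))"
    by (rule imp_trans[OF derivable.Five[OF 5]])
  from box_mono[OF this] have "l \<turnstile> imp (Dia (Box \<phi>)) (Box (Box (Box \<phi>)))"
    by (rule imp_trans[OF derivable.Five[OF 5]])
  then show ?thesis
    by (rule imp_trans[OF derivable_D[OF assms(1)]])
qed

lemma box_And: "l \<turnstile> imp (And (Box \<phi>) (Box \<psi>)) (Box (And \<phi> \<psi>))"
proof -
  have "l \<turnstile> imp (Box \<phi>) (Box (imp \<psi> (And \<phi> \<psi>)))"
    by (rule box_mono, rule Taut) (simp add: tautology_def)
  from imp_trans[OF this derivable.K] show ?thesis
    by (rule derivable_conseq) auto
qed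

lemma char_fm_decides:
  assumes "AxD \<in> l \<or> AxT \<in> l \<longrightarrow> Ax4 \<in> l \<or> Ax5 \<in> l"
    and "vars \<psi> \<subseteq> vars (all_true \<phi>)"
  shows "decides l (char_fm l \<phi>) \<psi>"
proof (rule decides_all[OF _ _ assms(2)])
  fix p assume "p \<in> vars (all_true \<phi>)"
  then show "decides l (char_fm l \<phi>) (Var p)"
    by (intro decidesI1 Taut) (auto simp: tautology_def char_fm_def prop_val_all_true)
next
  fix \<chi> assume \<chi>: "decides l (char_fm l \<phi>) \<chi>"
  show "decides l (char_fm l \<phi>) (Box \<chi>)"
  proof (cases "AxD \<in> l \<or> AxT \<in> l")
    case False
    have "l \<turnstile> imp (Box Bot) (Box \<chi>)"
      by (rule box_mono, rule Taut) (simp add: tautology_def)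
    then show ?thesis
      using False by (intro decidesI1, elim derivable_conseq) (simp add: char_fm_def)
  next
    case True
    let ?c = "all_true \<phi>"
    have distrib: "l \<turnstile> imp (And (Box ?c) (And (Box (Box ?c)) (Box (Box (Box ?c)))))
                 (Box (And ?c (And (Box ?c) (Box (Box ?c)))))"
      by (rule derivable_conseq2[OF box_And[of l ?c "And (Box ?c) (Box (Box ?c))"]
                 box_And[of l "Box ?c" "Box (Box ?c)"]]) auto
    \<comment> \<open>All successors inherit the formula, so whatever it forces is forced there too.
      A forced \<open>neg \<chi>\<close> gives \<open>Dia (neg \<chi>)\<close> because a successor
      exists.\<close>
    have step: "l \<turnstile> imp (char_fm l \<phi>) (Box (char_fm l \<phi>))"
      by (rule derivable_conseq2[OF distrib derivable_Box_Box[of l ?c]])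
        (use assms(1) True in \<open>simp_all add: char_fm_def\<close>)
    from \<chi> show ?thesis unfolding decides_def[of _ _ \<chi>]
    proof
      assume "l \<turnstile> imp (char_fm l \<phi>) \<chi>"
      then show ?thesis
        by (intro decidesI1 imp_trans[OF step box_mono])
    next
      assume "l \<turnstile> imp (char_fm l \<phi>) (neg \<chi>)"
      then have "l \<turnstile> imp (char_fm l \<phi>) (Dia (neg \<chi>))"
        by (intro imp_trans[OF step imp_trans[OF box_mono derivable_D[OF True]]])
      then show ?thesis
        by (intro decidesI2) simp
    qed
  qed
qed

section \<open>Correctness of the reduction\<close>

lemma subst_shift:
  assumes "\<And>p. s (2 * p + 1) = Var p"
  shows "subst s (shift \<phi>) = \<phi>"
  using assms by (induction \<phi>) (simp_all add: shift_def)

text \<open>The witness is a single point with all variables true, with a loop exactly when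
  \<open>D\<close> or \<open>T\<close> demands a successor.\<close>

lemma char_fm_consistent: "\<not> l \<turnstile> imp (char_fm l \<phi>) (NVar 0)"
proof
  define R where "R = (if AxD \<in> l \<or> AxT \<in> l then {((), ())} else {})"
  have "frame_for l UNIV R"
    by (auto simp: frame_for_def R_def trans_def)
  moreover assume "l \<turnstile> imp (char_fm l \<phi>) (NVar 0)"
  ultimately have "sem R (\<lambda>_ _. True) () (imp (char_fm l \<phi>) (NVar 0))"
    by (intro soundness[OF _ _ UNIV_I])
  moreover have "sem R (\<lambda>_ _. True) x (all_true \<phi>)" for x
    by (subst sem_prop_val) (simp add: prop_val_all_true)
  ultimately show False
    by (simp add: char_fm_def R_def split: if_splits)
qed

lemma reduction_correct:
  assumes "nontrivial_completeness_problem l"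
  shows "complete_for l (reduction l \<phi>) \<longleftrightarrow> l \<turnstile> \<phi>"
proof
  assume "l \<turnstile> \<phi>"
  then have "l \<turnstile> shift \<phi>"
    unfolding shift_def by (rule derivable_subst)
  then have "l \<turnstile> imp (reduction l \<phi>) (char_fm l \<phi>)"
    by (rule derivable_conseq) (simp add: reduction_def)
  \<comment> \<open>The hypothesis on \<open>l\<close> enters here: in the presence of
    \<open>D\<close> or \<open>T\<close> it forces \<open>4\<close> or \<open>5\<close>.\<close>
  moreover have "decides l (char_fm l \<phi>) \<psi>" if "vars \<psi> \<subseteq> vars (reduction l \<phi>)" for \<psi>
    using that trivial_completeness_problem[of l] assms
    by (intro char_fm_decides) (auto simp: vars_reduction)
  ultimately show "complete_for l (reduction l \<phi>)"
    unfolding complete_for_def decides_def by (blast intro: imp_trans)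
next
  assume "complete_for l (reduction l \<phi>)"
  moreover have "vars (Var 0) \<subseteq> vars (reduction l \<phi>)"
    by (simp add: reduction_def)
  ultimately have "l \<turnstile> imp (reduction l \<phi>) (Var 0) \<or> l \<turnstile> imp (reduction l \<phi>) (neg (Var 0))"
    unfolding complete_for_def by blast
  then consider "l \<turnstile> imp (reduction l \<phi>) (Var 0)" | "l \<turnstile> imp (reduction l \<phi>) (NVar 0)"
    by fastforce
  then show "l \<turnstile> \<phi>"
  proof cases
    case 1
    then have "l \<turnstile> Or (shift \<phi>) (Var 0)"
      by (rule derivable_conseq) (auto simp: reduction_def)
    \<comment> \<open>Replacing the fresh variable by \<open>Bot\<close> and undoing the renaming
      recovers \<open>\<phi>\<close> within the calculus, instead of constructing a
      countermodel.\<close>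
    then have "l \<turnstile> subst (\<lambda>p. if p = 0 then Bot else Var (p div 2)) (Or (shift \<phi>) (Var 0))"
      by (rule derivable_subst)
    then have "l \<turnstile> Or \<phi> Bot"
      by (simp add: subst_shift)
    then show ?thesis
      by (rule derivable_conseq) simp
  next
    case 2
    then have "l \<turnstile> imp (char_fm l \<phi>) (NVar 0)"
      by (rule derivable_conseq) (auto simp: reduction_def)
    with char_fm_consistent show ?thesis ..
  qed
qed

section \<open>Sequencing, branching and iteration of Turing machines\<close>

section \<open>Combining Turing machines\<close>

definition heads :: "tape list \<Rightarrow> nat list" where
  "heads ts = map (\<lambda>t. t 0) ts"

definition valid_acts :: "nat \<Rightarrow> nat \<Rightarrow> (nat \<times> int) list \<Rightarrow> bool" where
  "valid_acts k n as \<longleftrightarrow> length as = k \<and> (\<forall>(x, d) \<in> set as. x < n \<and> d \<in> {-1, 0, 1})"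

definition tm_over :: "nat \<Rightarrow> nat \<Rightarrow> tm \<Rightarrow> bool" where
  "tm_over k n M \<longleftrightarrow> ntapes M = k \<and> nsyms M = n \<and>
     (\<forall>q < nstates M. \<forall>ss. length ss = k \<and> set ss \<subseteq> {..<n} \<longrightarrow>
        fst (delta M q ss) \<le> nstates M \<and> valid_acts k n (snd (delta M q ss)))"

lemma wf_tm_iff: "wf_tm M \<longleftrightarrow> 1 \<le> ntapes M \<and> 3 \<le> nsyms M \<and> tm_over (ntapes M) (nsyms M) M"
  by (auto simp: wf_tm_def tm_over_def valid_acts_def split_beta)

lemma tm_overD:
  assumes "tm_over k n M" "q < nstates M" "length ss = k" "set ss \<subseteq> {..<n}"
  shows "fst (delta M q ss) \<le> nstates M" "valid_acts k n (snd (delta M q ss))"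
  using assms by (auto simp: tm_over_def)

definition exec :: "tm \<Rightarrow> nat \<Rightarrow> tape list \<Rightarrow> tape list \<Rightarrow> bool" where
  "exec M b ts ts' \<longleftrightarrow> (\<exists>m\<le>b. (step M ^^ m) (0, ts) = (nstates M, ts'))"

lemma exec_mono: "exec M b ts ts' \<Longrightarrow> b \<le> b' \<Longrightarrow> exec M b' ts ts'"
  by (auto simp: exec_def intro: order_trans)

lemma step_active:
  "q < nstates M \<Longrightarrow>
     step M (q, ts) = (fst (delta M q (heads ts)), map2 act (snd (delta M q (heads ts))) ts)"
  by (simp add: heads_def split_beta)

lemma step_halted: "\<not> q < nstates M \<Longrightarrow> step M (q, ts) = (q, ts)"
  by simp

declare step.simps [simp del]

text \<open>\<open>M\<close> is a part of \<open>M'\<close> whose states are renamed by \<open>r\<close>; the run of \<open>M\<close> may idle in its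
  halting state, which \<open>M'\<close> need not do.\<close>

lemma run_embed:
  assumes embed: "\<And>q ss. q < nstates M \<Longrightarrow>
      r q < nstates M' \<and> delta M' (r q) ss = map_prod r id (delta M q ss)"
  shows "(step M ^^ b) (q, ts) = (nstates M, ts') \<Longrightarrow>
    \<exists>m\<le>b. (step M' ^^ m) (r q, ts) = (r (nstates M), ts')"
proof (induction b arbitrary: q ts)
  case 0
  then show ?case by simp
next
  case (Suc b)
  show ?case
  proof (cases "q < nstates M")
    case True
    let ?q = "fst (delta M q (heads ts))" and ?ts = "map2 act (snd (delta M q (heads ts))) ts"
    have "step M' (r q, ts) = (r ?q, ?ts)"
      using embed[OF True] by (simp add: step_active)
    moreover obtain m where "m \<le> b" "(step M' ^^ m) (r ?q, ?ts) = (r (nstates M), ts')"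
      using Suc True by (auto simp: funpow_Suc_right step_active simp del: funpow.simps)
    ultimately have "(step M' ^^ Suc m) (r q, ts) = (r (nstates M), ts')"
      by (simp add: funpow_Suc_right del: funpow.simps)
    with \<open>m \<le> b\<close> show ?thesis by (intro exI[of _ "Suc m"]) simp
  next
    case False
    with Suc.prems have "(step M ^^ b) (q, ts) = (nstates M, ts')"
      by (simp add: funpow_Suc_right step_halted del: funpow.simps)
    with Suc.IH show ?thesis by (meson le_SucI)
  qed
qed

lemma exec_embed:
  assumes "\<And>q ss. q < nstates M \<Longrightarrow>
      r q < nstates M' \<and> delta M' (r q) ss = map_prod r id (delta M q ss)"
    and "exec M b ts ts'"
  obtains m where "m \<le> b" "(step M' ^^ m) (r 0, ts) = (r (nstates M), ts')"
proof -
  from assms(2) obtain m where "m \<le> b" "(step M ^^ m) (0, ts) = (nstates M, ts')"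
    by (auto simp: exec_def)
  with run_embed[of M r M' m 0 ts ts', OF assms(1)] show ?thesis
    using that by (meson order_trans)
qed

lemma run_trans:
  "(step M ^^ a) c = c1 \<Longrightarrow> (step M ^^ b) c1 = c2 \<Longrightarrow> (step M ^^ (a + b)) c = c2"
  by (subst add.commute) (simp add: funpow_add)

definition stay :: "nat list \<Rightarrow> (nat \<times> int) list" where
  "stay ss = map (\<lambda>s. (s, 0)) ss"

lemma act_stay [simp]: "act (t 0, 0) t = t"
  by auto

lemma map2_act_stay [simp]: "map2 act (stay (heads ts)) ts = ts"
  by (induction ts) (simp_all add: stay_def heads_def del: act.simps)

lemma valid_acts_stay: "length ss = k \<Longrightarrow> set ss \<subseteq> {..<n} \<Longrightarrow> valid_acts k n (stay ss)"
  by (auto simp: valid_acts_def stay_def)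

definition prim :: "nat \<Rightarrow> nat \<Rightarrow> (nat list \<Rightarrow> (nat \<times> int) list) \<Rightarrow> tm" where
  "prim k n a = \<lparr>ntapes = k, nstates = 1, nsyms = n, delta = \<lambda>q ss. (1, a ss)\<rparr>"

definition skip :: "nat \<Rightarrow> nat \<Rightarrow> tm" where
  "skip k n = \<lparr>ntapes = k, nstates = 0, nsyms = n, delta = \<lambda>q ss. (0, stay ss)\<rparr>"

text \<open>The halting state of \<open>A\<close> has the number at which the start state of
  \<open>B\<close> lands, so control passes on by itself and running times add up.\<close>

definition seq :: "tm \<Rightarrow> tm \<Rightarrow> tm" where
  "seq A B = \<lparr>ntapes = ntapes A, nstates = nstates A + nstates B, nsyms = nsyms A,
     delta = \<lambda>q ss. if q < nstates A then delta A q ss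
       else map_prod ((+) (nstates A)) id (delta B (q - nstates A) ss)\<rparr>"

text \<open>State \<open>0\<close> makes the test, followed by the states of \<open>A\<close> and
  then those of \<open>B\<close>. The halting state of \<open>A\<close> would fall on the start of
  \<open>B\<close> and is redirected to the common halting state.\<close>

definition if_renaming :: "tm \<Rightarrow> tm \<Rightarrow> nat \<Rightarrow> nat" where
  "if_renaming A B q = (if q < nstates A then Suc q else Suc (nstates A + nstates B))"

definition if_tm :: "(nat list \<Rightarrow> bool) \<Rightarrow> tm \<Rightarrow> tm \<Rightarrow> tm" where
  "if_tm P A B = \<lparr>ntapes = ntapes A, nstates = Suc (nstates A + nstates B), nsyms = nsyms A,
     delta = \<lambda>q ss.
       if q = 0 then (if P ss then if_renaming A B 0 else Suc (nstates A), stay ss)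
       else if q \<le> nstates A then map_prod (if_renaming A B) id (delta A (q - 1) ss)
       else map_prod (\<lambda>q. Suc (nstates A + q)) id (delta B (q - Suc (nstates A)) ss)\<rparr>"

text \<open>The halting state of the body is identified with the test state
  \<open>0\<close>.\<close>

definition loop_renaming :: "tm \<Rightarrow> nat \<Rightarrow> nat" where
  "loop_renaming A q = (if q < nstates A then Suc q else 0)"

definition loop :: "(nat list \<Rightarrow> bool) \<Rightarrow> tm \<Rightarrow> tm" where
  "loop P A = \<lparr>ntapes = ntapes A, nstates = Suc (nstates A), nsyms = nsyms A,
     delta = \<lambda>q ss.
       if q = 0 then (if P ss then loop_renaming A 0 else Suc (nstates A), stay ss)
       else map_prod (loop_renaming A) id (delta A (q - 1) ss)\<rparr>"

lemma tm_over_prim: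
  "(\<And>ss. length ss = k \<Longrightarrow> set ss \<subseteq> {..<n} \<Longrightarrow> valid_acts k n (a ss)) \<Longrightarrow> tm_over k n (prim k n a)"
  by (simp add: tm_over_def prim_def)

lemma tm_over_skip: "tm_over k n (skip k n)"
  by (simp add: tm_over_def skip_def)

lemma tm_over_seq:
  assumes A: "tm_over k n A" and B: "tm_over k n B"
  shows "tm_over k n (seq A B)"
  unfolding tm_over_def
proof (intro conjI allI impI)
  fix q ss assume q: "q < nstates (seq A B)" and ss: "length ss = k \<and> set ss \<subseteq> {..<n}"
  show "fst (delta (seq A B) q ss) \<le> nstates (seq A B)"
    "valid_acts k n (snd (delta (seq A B) q ss))"
    using tm_overD[OF A, of q ss] tm_overD[OF B, of "q - nstates A" ss] q ss
    by (auto simp: seq_def)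
qed (use A in \<open>simp_all add: seq_def tm_over_def\<close>)

lemma tm_over_if_tm:
  assumes A: "tm_over k n A" and B: "tm_over k n B"
  shows "tm_over k n (if_tm P A B)"
  unfolding tm_over_def
proof (intro conjI allI impI)
  fix q ss assume q: "q < nstates (if_tm P A B)" and ss: "length ss = k \<and> set ss \<subseteq> {..<n}"
  show "fst (delta (if_tm P A B) q ss) \<le> nstates (if_tm P A B)"
    "valid_acts k n (snd (delta (if_tm P A B) q ss))"
    using tm_overD[OF A, of "q - 1" ss] tm_overD[OF B, of "q - Suc (nstates A)" ss] q ss
    by (auto simp: if_tm_def if_renaming_def valid_acts_stay)
qed (use A in \<open>simp_all add: if_tm_def tm_over_def\<close>)

lemma tm_over_loop:
  assumes A: "tm_over k n A"
  shows "tm_over k n (loop P A)"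
  unfolding tm_over_def
proof (intro conjI allI impI)
  fix q ss assume q: "q < nstates (loop P A)" and ss: "length ss = k \<and> set ss \<subseteq> {..<n}"
  show "fst (delta (loop P A) q ss) \<le> nstates (loop P A)"
    "valid_acts k n (snd (delta (loop P A) q ss))"
    using tm_overD[OF A, of "q - 1" ss] q ss
    by (auto simp: loop_def loop_renaming_def valid_acts_stay)
qed (use A in \<open>simp_all add: loop_def tm_over_def\<close>)

lemma exec_prim: "exec (prim k n a) 1 ts (map2 act (a (heads ts)) ts)"
  unfolding exec_def by (intro exI[of _ 1]) (simp add: step_active prim_def)

lemma exec_skip: "exec (skip k n) 0 ts ts"
  by (simp add: exec_def skip_def)

lemma exec_seq:
  assumes "exec A a ts ts1" "exec B b ts1 ts2"
  shows "exec (seq A B) (a + b) ts ts2"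
proof -
  obtain m where m: "m \<le> a" "(step (seq A B) ^^ m) (0, ts) = (nstates A, ts1)"
    by (rule exec_embed[of A "\<lambda>q. q" "seq A B", OF _ assms(1)])
      (auto simp: seq_def map_prod_def split_beta)
  obtain m' where m': "m' \<le> b"
    "(step (seq A B) ^^ m') (nstates A + 0, ts1) = (nstates A + nstates B, ts2)"
    by (rule exec_embed[of B "(+) (nstates A)" "seq A B", OF _ assms(2)]) (auto simp: seq_def)
  have "(step (seq A B) ^^ (m + m')) (0, ts) = (nstates (seq A B), ts2)"
    using run_trans[OF m(2)] m'(2) by (simp add: seq_def)
  with m(1) m'(1) show ?thesis
    unfolding exec_def by (intro exI[of _ "m + m'"]) simp
qed

lemma exec_if_tm:
  assumes "if P (heads ts) then exec A a ts ts' else exec B a ts ts'"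
  shows "exec (if_tm P A B) (Suc a) ts ts'"
proof -
  let ?M = "if_tm P A B" and ?r = "if_renaming A B"
  have *: "\<exists>m\<le>a. (step ?M ^^ m) (step ?M (0, ts)) = (nstates ?M, ts')"
  proof (cases "P (heads ts)")
    case True
    with assms have "exec A a ts ts'" by simp
    then obtain m where "m \<le> a" "(step ?M ^^ m) (?r 0, ts) = (?r (nstates A), ts')"
      by (rule exec_embed[of A ?r ?M, rotated]) (auto simp: if_tm_def if_renaming_def)
    with True show ?thesis
      by (auto simp: step_active if_tm_def if_renaming_def)
  next
    case False
    with assms have "exec B a ts ts'" by simp
    then obtain m where "m \<le> a"
      "(step ?M ^^ m) (Suc (nstates A + 0), ts) = (Suc (nstates A + nstates B), ts')"
      by (rule exec_embed[of B "\<lambda>q. Suc (nstates A + q)" ?M, rotated]) (auto simp: if_tm_def)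
    with False show ?thesis
      by (auto simp: step_active if_tm_def)
  qed
  then obtain m where "m \<le> a" "(step ?M ^^ Suc m) (0, ts) = (nstates ?M, ts')"
    by (auto simp: funpow_Suc_right simp del: funpow.simps)
  then show ?thesis
    unfolding exec_def by (intro exI[of _ "Suc m"]) simp
qed

lemma exec_loop_stop:
  assumes "\<not> P (heads ts)"
  shows "exec (loop P A) 1 ts ts"
  unfolding exec_def using assms by (intro exI[of _ 1]) (simp add: step_active loop_def)

lemma exec_loop_step:
  assumes "P (heads ts)" "exec A a ts ts1" "exec (loop P A) b ts1 ts2"
  shows "exec (loop P A) (Suc (a + b)) ts ts2"
proof -
  let ?M = "loop P A" and ?r = "loop_renaming A"
  have first: "step ?M (0, ts) = (?r 0, ts)"
    using assms(1) by (simp add: step_active loop_def)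
  obtain m where m: "m \<le> a" "(step ?M ^^ m) (?r 0, ts) = (?r (nstates A), ts1)"
    by (rule exec_embed[of A ?r ?M, OF _ assms(2)]) (auto simp: loop_def loop_renaming_def)
  obtain m' where m': "m' \<le> b" "(step ?M ^^ m') (0, ts1) = (nstates ?M, ts2)"
    using assms(3) by (auto simp: exec_def)
  have "(step ?M ^^ (m + m')) (?r 0, ts) = (nstates ?M, ts2)"
    by (rule run_trans[OF m(2)]) (simp add: m'(2) loop_renaming_def)
  then have "(step ?M ^^ Suc (m + m')) (0, ts) = (nstates ?M, ts2)"
    by (simp add: funpow_Suc_right first del: funpow.simps)
  with m(1) m'(1) show ?thesis
    unfolding exec_def by (intro exI[of _ "Suc (m + m')"]) simp
qed

lemma exec_loop_count:
  assumes "\<And>m. m < N \<Longrightarrow> P (heads (c m)) \<and> exec A a (c m) (c (Suc m))" "\<not> P (heads (c N))"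
  shows "exec (loop P A) (Suc (N * Suc a)) (c 0) (c N)"
proof -
  \<comment> \<open>Here \<open>m\<close> counts the rounds still to come, because
    \<open>exec_loop_step\<close> adds a round at the front.\<close>
  have "exec (loop P A) (Suc (m * Suc a)) (c (N - m)) (c N)" if "m \<le> N" for m
    using that
  proof (induction m)
    case 0
    then show ?case using exec_loop_stop assms(2) by simp
  next
    case (Suc m)
    then have "exec (loop P A) (Suc (a + Suc (m * Suc a))) (c (N - Suc m)) (c N)"
      using assms(1)[of "N - Suc m"] by (intro exec_loop_step) (simp_all add: Suc_diff_Suc)
    then show ?case by (rule exec_mono) simp
  qed
  from this[of N] show ?thesis by simp
qed

section \<open>Growth of tapes and a spare tape\<close>

section \<open>Adding a tape\<close>

text \<open>The invariant serves twice: it keeps the scanned symbols in the alphabet, and its count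
  of nonblank cells will bound the length of the computed word.\<close>

definition bounded_tapes :: "nat \<Rightarrow> nat \<Rightarrow> nat \<Rightarrow> tape list \<Rightarrow> bool" where
  "bounded_tapes k n N ts \<longleftrightarrow> length ts = k \<and>
     (\<forall>t\<in>set ts. (\<forall>x. t x < n) \<and> finite {x. t x \<noteq> 0} \<and> card {x. t x \<noteq> 0} \<le> N)"

text \<open>Only the scanned cell can become nonblank; the head movement merely translates the
  support.\<close>

lemma support_act:
  assumes "finite {x. t x \<noteq> 0}"
  shows "finite {y. act (x, d) t y \<noteq> 0} \<and> card {y. act (x, d) t y \<noteq> 0} \<le> Suc (card {x. t x \<noteq> 0})"
proof -
  have sub: "{y. act (x, d) t y \<noteq> 0} \<subseteq> (\<lambda>y. y - d) ` insert 0 {x. t x \<noteq> 0}" (is "_ \<subseteq> ?B")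
  proof
    fix y assume "y \<in> {y. act (x, d) t y \<noteq> 0}"
    then have "y + d \<in> insert 0 {x. t x \<noteq> 0}" by (auto split: if_splits)
    then have "y + d - d \<in> ?B" by (rule imageI)
    then show "y \<in> ?B" by simp
  qed
  have fin: "finite ?B" using assms by simp
  have "card ?B \<le> card (insert 0 {x. t x \<noteq> 0})"
    using assms by (intro card_image_le) simp
  also have "\<dots> \<le> Suc (card {x. t x \<noteq> 0})"
    by (rule card_insert_le_m1) auto
  finally show ?thesis
    using card_mono[OF fin sub] finite_subset[OF sub fin] by simp
qed

lemma bounded_tapes_step:
  assumes "tm_over k n M" "bounded_tapes k n N ts"
  shows "bounded_tapes k n (Suc N) (snd (step M (q, ts)))"
proof (cases "q < nstates M")
  case False
  then show ?thesis
    using assms(2) by (auto simp: step_halted bounded_tapes_def)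
next
  case True
  let ?as = "snd (delta M q (heads ts))"
  have "length (heads ts) = k" "set (heads ts) \<subseteq> {..<n}"
    using assms(2) by (auto simp: heads_def bounded_tapes_def)
  with tm_overD[OF assms(1) True] have as: "valid_acts k n ?as" by blast
  have "(\<forall>y. t' y < n) \<and> finite {x. t' x \<noteq> 0} \<and> card {x. t' x \<noteq> 0} \<le> Suc N"
    if "t' \<in> set (map2 act ?as ts)" for t'
  proof -
    from that obtain x d t where *: "(x, d) \<in> set ?as" "t \<in> set ts" "t' = act (x, d) t"
      by (force dest: set_zip_leftD set_zip_rightD)
    then have "x < n" "\<forall>y. t y < n" "finite {x. t x \<noteq> 0}" "card {x. t x \<noteq> 0} \<le> N"
      using as assms(2) by (auto simp: valid_acts_def bounded_tapes_def)
    with support_act[of t x d] show ?thesis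
      unfolding *(3) by (auto simp del: Suc_le_mono intro: order_trans)
  qed
  with as assms(2) show ?thesis
    by (simp add: step_active True bounded_tapes_def valid_acts_def)
qed

lemma bounded_tapes_run:
  assumes "tm_over k n M" "bounded_tapes k n N ts"
  shows "bounded_tapes k n (N + m) (snd ((step M ^^ m) (q, ts)))"
proof (induction m)
  case (Suc m)
  show ?case
    using bounded_tapes_step[OF assms(1) Suc.IH, of "fst ((step M ^^ m) (q, ts))"] by simp
qed (simp add: assms)

definition add_tape :: "tm \<Rightarrow> tm" where
  "add_tape M = \<lparr>ntapes = Suc (ntapes M), nstates = nstates M, nsyms = nsyms M,
     delta = \<lambda>q ss. (fst (delta M q (butlast ss)), snd (delta M q (butlast ss)) @ [(last ss, 0)])\<rparr>"

lemma tm_over_add_tape: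
  assumes "tm_over k n M"
  shows "tm_over (Suc k) n (add_tape M)"
  unfolding tm_over_def
proof (intro conjI allI impI)
  fix q ss assume "q < nstates (add_tape M)" and ss: "length ss = Suc k \<and> set ss \<subseteq> {..<n}"
  then have q: "q < nstates M" by (simp add: add_tape_def)
  have "length (butlast ss) = k" "set (butlast ss) \<subseteq> {..<n}"
    using ss by (auto dest: in_set_butlastD)
  note D = tm_overD[OF assms q this]
  have "last ss \<in> set ss" using ss by (intro last_in_set) auto
  with ss have "last ss < n" by auto
  with D show "fst (delta (add_tape M) q ss) \<le> nstates (add_tape M)"
    "valid_acts (Suc k) n (snd (delta (add_tape M) q ss))"
    by (auto simp: add_tape_def valid_acts_def)
qed (use assms in \<open>simp_all add: add_tape_def tm_over_def\<close>)

text \<open>The additional action must line up with the additional tape, so \<open>M\<close> has to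
  supply exactly one action per old tape. The invariant ensures this along the whole run.\<close>

lemma run_add_tape:
  assumes "tm_over k n M" "bounded_tapes k n N ts"
  shows "(step (add_tape M) ^^ m) (q, ts @ [t]) =
    map_prod id (\<lambda>ts. ts @ [t]) ((step M ^^ m) (q, ts))"
proof (induction m)
  case (Suc m)
  obtain q' ts' where c: "(step M ^^ m) (q, ts) = (q', ts')" by fastforce
  have ts': "bounded_tapes k n (N + m) ts'"
    using bounded_tapes_run[OF assms, of m q] by (simp add: c)
  show ?case
  proof (cases "q' < nstates M")
    case True
    have "length (heads ts') = k" "set (heads ts') \<subseteq> {..<n}"
      using ts' by (auto simp: heads_def bounded_tapes_def)
    with tm_overD[OF assms(1) True] have "length (snd (delta M q' (heads ts'))) = length ts'"
      using ts' by (auto simp: valid_acts_def bounded_tapes_def)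
    moreover have "heads (ts' @ [t]) = heads ts' @ [t 0]"
      by (simp add: heads_def)
    moreover have "q' < nstates (add_tape M)"
      using True by (simp add: add_tape_def)
    ultimately show ?thesis
      using True c Suc.IH by (simp add: step_active) (simp add: add_tape_def del: act.simps)
  next
    case False
    then show ?thesis
      using c Suc.IH by (simp add: step_halted add_tape_def)
  qed
qed simp

section \<open>Machines with one input and one output tape\<close>

section \<open>Reading one tape and writing another\<close>

definition io :: "nat \<Rightarrow> nat \<Rightarrow> (nat \<Rightarrow> nat \<times> int) \<Rightarrow> (nat \<Rightarrow> nat \<times> int) \<Rightarrow> tm" where
  "io j n a b =
     prim (Suc (Suc j)) n (\<lambda>ss. stay (take j ss) @ [a (ss ! j), b (ss ! Suc j)])"

definition valid_act_fun :: "nat \<Rightarrow> (nat \<Rightarrow> nat \<times> int) \<Rightarrow> bool" where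
  "valid_act_fun n a \<longleftrightarrow> (\<forall>s < n. fst (a s) < n \<and> snd (a s) \<in> {-1, 0, 1})"

text \<open>Restores absolute addresses: the contents \<open>t\<close> stay fixed and
  \<open>i\<close> is the head position.\<close>

definition shifted :: "tape \<Rightarrow> int \<Rightarrow> tape" where
  "shifted t i = (\<lambda>x. t (x + i))"

lemma shifted_0 [simp]: "shifted t 0 = t"
  by (simp add: shifted_def)

lemma shifted_apply: "shifted t i x = t (x + i)"
  by (simp add: shifted_def)

lemma act_shifted [simp]: "act (t i, d) (shifted t i) = shifted t (i + d)"
proof
  fix x
  show "act (t i, d) (shifted t i) x = shifted t (i + d) x"
  proof (cases "x + d = 0")
    case True
    then have "d = - x" by simp
    then show ?thesis by (simp add: shifted_def)
  qed (simp add: shifted_def algebra_simps)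
qed

text \<open>The head is on the first cell after the word.\<close>

definition written :: "bool list \<Rightarrow> tape" where
  "written u = (\<lambda>x. if - int (length u) \<le> x \<and> x < 0 then bit_sym (u ! nat (x + int (length u))) else 0)"

lemma written_Nil [simp]: "written [] = blank_tape"
  by (auto simp: written_def blank_tape_def)

lemma bit_sym_pos [simp]: "0 < bit_sym x"
  by (simp add: bit_sym_def)

lemma bit_sym_inject [simp]: "bit_sym x = bit_sym y \<longleftrightarrow> x = y"
  by (simp add: bit_sym_def)

lemma act_written [simp]: "act (bit_sym x, 1) (written u) = written (u @ [x])"
proof
  fix y :: int
  \<comment> \<open>After the move to the right, the new symbol is in cell
    \<open>-1\<close>.\<close>
  consider "y = -1" | "y < -1" | "y \<ge> 0" by linarith
  then show "act (bit_sym x, 1) (written u) y = written (u @ [x]) y"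
  proof cases
    case 2
    then have "nat (y + 1 + int (length u)) < length u" if "- int (length u) \<le> y + 1"
      using that by linarith
    with 2 show ?thesis
      by (auto simp: written_def nth_append algebra_simps)
  qed (auto simp: written_def nth_append)
qed

fun spells :: "tape \<Rightarrow> int \<Rightarrow> bool list \<Rightarrow> bool" where
  "spells t i [] \<longleftrightarrow> True"
| "spells t i (x # u) \<longleftrightarrow> t i = bit_sym x \<and> spells t (i + 1) u"

lemma spells_append [simp]:
  "spells t i (u @ v) \<longleftrightarrow> spells t i u \<and> spells t (i + int (length u)) v"
  by (induction u arbitrary: i) (simp_all add: algebra_simps)

lemma spells_iff: "spells t i u \<longleftrightarrow> (\<forall>m < length u. t (i + int m) = bit_sym (u ! m))"
proof (induction u arbitrary: i)
  case (Cons x u)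
  show ?case by (simp add: Cons All_less_Suc2 algebra_simps)
qed simp

text \<open>There are \<open>j\<close> idle tapes, then the input tape with index \<open>j\<close> and the output tape with index
  \<open>Suc j\<close>.\<close>

locale two_tapes =
  fixes j n :: nat
  assumes n: "3 \<le> n"
begin

abbreviation "over \<equiv> tm_over (Suc (Suc j)) n"

lemma over_io:
  assumes "valid_act_fun n a" "valid_act_fun n b"
  shows "over (io j n a b)"
  unfolding io_def
proof (rule tm_over_prim)
  fix ss :: "nat list" assume ss: "length ss = Suc (Suc j)" "set ss \<subseteq> {..<n}"
  then have "ss ! j \<in> set ss" "ss ! Suc j \<in> set ss" by simp_all
  with ss have "ss ! j < n" "ss ! Suc j < n" by blast+
  with assms have "fst (a (ss ! j)) < n \<and> snd (a (ss ! j)) \<in> {-1, 0, 1}"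
    "fst (b (ss ! Suc j)) < n \<and> snd (b (ss ! Suc j)) \<in> {-1, 0, 1}"
    by (auto simp: valid_act_fun_def)
  moreover have "valid_acts j n (stay (take j ss))"
    using ss by (intro valid_acts_stay) (auto dest: in_set_takeD)
  ultimately show "valid_acts (Suc (Suc j)) n (stay (take j ss) @ [a (ss ! j), b (ss ! Suc j)])"
    by (auto simp: valid_acts_def)
qed

lemma exec_io:
  assumes "length J = j"
  shows "exec (io j n a b) 1 (J @ [x, y]) (J @ [act (a (x 0)) x, act (b (y 0)) y])"
proof -
  let ?ss = "heads (J @ [x, y])"
  have ss: "?ss = heads J @ [x 0, y 0]" "length (heads J) = j"
    using assms by (simp_all add: heads_def)
  then have "map2 act (stay (take j ?ss) @ [a (?ss ! j), b (?ss ! Suc j)]) (J @ [x, y]) =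
      J @ [act (a (x 0)) x, act (b (y 0)) y]"
    using assms by (simp add: nth_append stay_def[of "heads J"] del: act.simps)
      (simp add: stay_def[symmetric] del: act.simps)
  then show ?thesis
    using exec_prim[of "Suc (Suc j)" n
        "\<lambda>ss. stay (take j ss) @ [a (ss ! j), b (ss ! Suc j)]" "J @ [x, y]"]
    by (simp only: io_def)
qed

definition emit :: "bool \<Rightarrow> tm" where
  "emit x = io j n (\<lambda>s. (s, 0)) (\<lambda>s. (bit_sym x, 1))"

definition move :: "int \<Rightarrow> tm" where
  "move d = io j n (\<lambda>s. (s, d)) (\<lambda>s. (s, 0))"

primrec emits :: "bool list \<Rightarrow> tm" where
  "emits [] = skip (Suc (Suc j)) n"
| "emits (x # u) = seq (emit x) (emits u)"

definition branch :: "(bool \<Rightarrow> tm) \<Rightarrow> tm" where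
  "branch P = if_tm (\<lambda>ss. ss ! j = bit_sym True) (P True) (P False)"

text \<open>During the passes the input \<open>T\<close> is left intact and the output grows only at
  its end, so a head position and a word describe all that changes.\<close>

definition config :: "tape list \<Rightarrow> tape \<Rightarrow> int \<Rightarrow> bool list \<Rightarrow> tape list" where
  "config J T i u = J @ [shifted T i, written u]"

lemma over_emit: "over (emit x)"
  unfolding emit_def using n by (intro over_io) (auto simp: valid_act_fun_def bit_sym_def)

lemma over_move: "d \<in> {-1, 0, 1} \<Longrightarrow> over (move d)"
  unfolding move_def using n by (intro over_io) (auto simp: valid_act_fun_def)

lemma over_emits: "over (emits u)"
  by (induction u) (simp_all add: tm_over_skip tm_over_seq over_emit)

lemma over_branch: "(\<And>x. over (P x)) \<Longrightarrow> over (branch P)"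
  unfolding branch_def by (intro tm_over_if_tm)

end

locale two_tapes_run = two_tapes +
  fixes J :: "tape list" and T :: tape
  assumes J: "length J = j"
begin

abbreviation "conf \<equiv> config J T"

lemma heads_conf [simp]: "heads (conf i u) ! j = T i"
  using J by (simp add: config_def heads_def nth_append shifted_apply)

lemma exec_emit: "exec (emit x) 1 (conf i u) (conf i (u @ [x]))"
proof -
  have "act (T i, 0) (shifted T i) = shifted T i"
    by (simp del: act.simps)
  then show ?thesis
    using exec_io[OF J, of "\<lambda>s. (s, 0)" "\<lambda>s. (bit_sym x, 1)" "shifted T i" "written u"]
    by (simp add: emit_def config_def shifted_apply del: act.simps)
qed

lemma exec_move: "exec (move d) 1 (conf i u) (conf (i + d) u)"
proof -
  have "act (written u 0, 0) (written u) = written u"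
    by (rule act_stay)
  then show ?thesis
    using exec_io[OF J, of "\<lambda>s. (s, d)" "\<lambda>s. (s, 0)" "shifted T i" "written u"]
    by (simp add: move_def config_def shifted_apply del: act.simps)
qed

lemma exec_emits: "exec (emits v) (length v) (conf i u) (conf i (u @ v))"
proof (induction v arbitrary: u)
  case Nil
  then show ?case by (simp add: exec_skip)
next
  case (Cons x v)
  show ?case
    using exec_seq[OF exec_emit[of x i u] Cons.IH[of "u @ [x]"]] by simp
qed

lemma exec_branch:
  assumes "T i = bit_sym x" "exec (P x) a (conf i u) c"
  shows "exec (branch P) (Suc a) (conf i u) c"
  unfolding branch_def using assms by (intro exec_if_tm) (cases x; simp)

end

section \<open>A finite-state transducer on formula codes\<close>

section \<open>Token-wise translation of encoded formulas\<close>

text \<open>Indices are copied unchanged, so bits that \<open>h\<close> adds behind a literal token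
  become low-order bits of the new index.\<close>

primrec transduce :: "(bool \<Rightarrow> bool \<Rightarrow> bool \<Rightarrow> bool list) \<Rightarrow> fm \<Rightarrow> bool list" where
  "transduce h Bot = h False False False"
| "transduce h Top = h False False True"
| "transduce h (Var p) = h False True False @ enc_nat p"
| "transduce h (NVar p) = h False True True @ enc_nat p"
| "transduce h (And \<phi> \<psi>) = h True False False @ transduce h \<phi> @ transduce h \<psi>"
| "transduce h (Or \<phi> \<psi>) = h True False True @ transduce h \<phi> @ transduce h \<psi>"
| "transduce h (Box \<phi>) = h True True False @ transduce h \<phi>"
| "transduce h (Dia \<phi>) = h True True True @ transduce h \<phi>"

context two_tapes
begin

text \<open>Each round consumes a continuation mark and a bit; the loop stops at the end mark
  \<open>False\<close>, which is copied separately.\<close>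

definition copy_nat :: tm where
  "copy_nat = seq
     (loop (\<lambda>ss. ss ! j = bit_sym True)
       (seq (emit True) (seq (move 1) (seq (branch emit) (move 1)))))
     (seq (emit False) (move 1))"

text \<open>Nested branching stores the three bits in the control state. The pattern
  \<open>\<not> x \<and> y\<close> singles out the literals, the only tokens followed by an
  index.\<close>

definition token :: "(bool \<Rightarrow> bool \<Rightarrow> bool \<Rightarrow> bool list) \<Rightarrow> tm" where
  "token h =
     branch (\<lambda>x. seq (move 1) (branch (\<lambda>y. seq (move 1) (branch (\<lambda>z. seq (move 1)
       (seq (emits (h x y z)) (if \<not> x \<and> y then copy_nat else emits [])))))))"

definition pass :: "(bool \<Rightarrow> bool \<Rightarrow> bool \<Rightarrow> bool list) \<Rightarrow> tm" where
  "pass h = loop (\<lambda>ss. ss ! j \<noteq> 0) (token h)"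

definition rewind :: tm where
  "rewind = seq (move (-1)) (seq (loop (\<lambda>ss. ss ! j \<noteq> 0) (move (-1))) (move 1))"

primrec passes :: "(bool list \<times> (bool \<Rightarrow> bool \<Rightarrow> bool \<Rightarrow> bool list)) list \<Rightarrow> tm" where
  "passes [] = skip (Suc (Suc j)) n"
| "passes (x # xs) =
     seq (emits (fst x)) (seq (pass (snd x)) (seq rewind (passes xs)))"

lemma over_copy_nat: "over copy_nat"
  unfolding copy_nat_def
  by (intro tm_over_seq tm_over_loop over_emit over_move over_branch) simp_all

lemma over_token: "over (token h)"
  unfolding token_def
  by (intro over_branch tm_over_seq over_move over_emits) (simp_all add: over_copy_nat over_emits del: emits.simps)

lemma over_passes: "over (passes xs)"
  by (induction xs)
    (simp_all add: tm_over_skip tm_over_seq tm_over_loop over_emits over_token over_move pass_def rewind_def)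

end

context two_tapes_run
begin

lemma exec_copy_nat:
  assumes "spells T i (enc_nat p)"
  shows "exec copy_nat (3 * length (enc_nat p)) (conf i u)
    (conf (i + int (length (enc_nat p))) (u @ enc_nat p))"
proof -
  let ?body = "seq (emit True) (seq (move 1) (seq (branch emit) (move 1)))"
  let ?loop = "loop (\<lambda>ss. ss ! j = bit_sym True) ?body"
  \<comment> \<open>A round takes six steps for two symbols, and the last test takes one. That the
    code ends in \<open>False\<close> is proved along with this, as it determines where the loop
    stops.\<close>
  have "exec ?loop (3 * length (enc_nat p) - 2) (conf i u)
      (conf (i + int (length (enc_nat p)) - 1) (u @ butlast (enc_nat p)))
    \<and> enc_nat p = butlast (enc_nat p) @ [False]"
    using assms
  proof (induction p arbitrary: i u rule: less_induct)
    case (less p)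
    show ?case
    proof (cases "p = 0")
      case True
      with less.prems show ?thesis
        using exec_loop_stop[of "\<lambda>ss. ss ! j = bit_sym True" "conf i u" ?body] by simp
    next
      case False
      then have p: "enc_nat p = True # odd p # enc_nat (p div 2)"
        by (intro enc_nat_pos) simp
      have "p div 2 < p" using False by simp
      moreover have "spells T (i + 2) (enc_nat (p div 2))"
        using less.prems by (simp add: p add.commute)
      ultimately have IH: "exec ?loop (3 * length (enc_nat (p div 2)) - 2)
          (conf (i + 2) (u @ [True, odd p]))
          (conf (i + 2 + int (length (enc_nat (p div 2))) - 1)
            ((u @ [True, odd p]) @ butlast (enc_nat (p div 2))))"
        and last: "enc_nat (p div 2) = butlast (enc_nat (p div 2)) @ [False]"
        using less.IH by blast+
      have len: "enc_nat (p div 2) \<noteq> []"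
        using last by (metis append_is_Nil_conv list.distinct(1))
      have bits: "T i = bit_sym True" "T (i + 1) = bit_sym (odd p)"
        using less.prems by (simp_all add: p)
      have "exec (branch emit) (Suc 1) (conf (i + 1) (u @ [True])) (conf (i + 1) ((u @ [True]) @ [odd p]))"
        by (rule exec_branch[OF bits(2) exec_emit])
      then have "exec ?body (1 + (1 + (Suc 1 + 1))) (conf i u)
          (conf (i + 1 + 1) ((u @ [True]) @ [odd p]))"
        by (intro exec_seq[OF exec_emit exec_seq[OF exec_move exec_seq[OF _ exec_move]]])
      moreover have "1 + (1 + (Suc 1 + 1)) = (5::nat)" "i + 1 + 1 = i + 2"
        "(u @ [True]) @ [odd p] = u @ [True, odd p]"
        by simp_all
      ultimately have body: "exec ?body 5 (conf i u) (conf (i + 2) (u @ [True, odd p]))"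
        by metis
      have "exec ?loop (Suc (5 + (3 * length (enc_nat (p div 2)) - 2))) (conf i u)
          (conf (i + 2 + int (length (enc_nat (p div 2))) - 1)
            ((u @ [True, odd p]) @ butlast (enc_nat (p div 2))))"
        by (rule exec_loop_step[OF _ body IH]) (simp add: bits)
      moreover have "Suc (5 + (3 * length (enc_nat (p div 2)) - 2)) = 3 * length (enc_nat p) - 2"
        using len by (cases "enc_nat (p div 2)") (simp_all add: p)
      moreover have "(u @ [True, odd p]) @ butlast (enc_nat (p div 2)) = u @ butlast (enc_nat p)"
        using len by (simp add: p)
      moreover have "i + 2 + int (length (enc_nat (p div 2))) - 1 = i + int (length (enc_nat p)) - 1"
        by (simp add: p)
      ultimately show ?thesis
        using last len by (simp add: p)
    qed
  qed
  then have loop: "exec ?loop (3 * length (enc_nat p) - 2) (conf i u)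
      (conf (i + int (length (enc_nat p)) - 1) (u @ butlast (enc_nat p)))"
    and last: "enc_nat p = butlast (enc_nat p) @ [False]" by blast+
  have "exec copy_nat (3 * length (enc_nat p) - 2 + (1 + 1)) (conf i u)
      (conf (i + int (length (enc_nat p)) - 1 + 1) ((u @ butlast (enc_nat p)) @ [False]))"
    unfolding copy_nat_def by (rule exec_seq[OF loop exec_seq[OF exec_emit exec_move]])
  moreover have "0 < length (enc_nat p)"
    by (subst last) simp
  then have "3 * length (enc_nat p) - 2 + (1 + 1) = 3 * length (enc_nat p)"
    by linarith
  moreover have "(u @ butlast (enc_nat p)) @ [False] = u @ enc_nat p"
    by (subst (2) last) simp
  ultimately show ?thesis by simp
qed

text \<open>Three tests, three moves and at most five emitted symbols cost at most \<open>11\<close>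
  steps; five is the length of a literal token with one inserted pair of index symbols.\<close>

lemma exec_token:
  assumes "spells T i [x, y, z]" "length (h x y z) \<le> 5"
    and "exec (if \<not> x \<and> y then copy_nat else emits []) a (conf (i + 3) (u @ h x y z)) c"
  shows "exec (token h) (11 + a) (conf i u) c"
proof -
  have bits: "T i = bit_sym x" "T (i + 1) = bit_sym y" "T (i + 1 + 1) = bit_sym z"
    using assms(1) by simp_all
  have cont: "exec (if \<not> x \<and> y then copy_nat else emits []) a
      (conf (i + 1 + 1 + 1) (u @ h x y z)) c"
    using assms(3) by (simp add: add.commute)
  have "exec (token h) (Suc (1 + Suc (1 + Suc (1 + (length (h x y z) + a))))) (conf i u) c"
    unfolding token_def
    by (rule exec_branch[OF bits(1)], rule exec_seq[OF exec_move],
        rule exec_branch[OF bits(2)], rule exec_seq[OF exec_move],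
        rule exec_branch[OF bits(3)], rule exec_seq[OF exec_move],
        rule exec_seq[OF exec_emits cont])
  then show ?thesis
    using assms(2) by (elim exec_mono) simp
qed

text \<open>The cost is rounded up to six steps per input symbol, a rate that adds up over
  subformulas.\<close>

lemma pass_token:
  assumes "spells T i [x, y, z]" "length (h x y z) \<le> 5" "\<not> (\<not> x \<and> y)"
    and "exec (pass h) b (conf (i + 3) (u @ h x y z)) c"
  shows "exec (pass h) (18 + b) (conf i u) c"
proof -
  have "exec (token h) (11 + 0) (conf i u) (conf (i + 3) (u @ h x y z))"
    by (rule exec_token[of i x y z h, OF assms(1,2)]) (use assms(3) in \<open>auto simp: exec_skip\<close>)
  then have "exec (pass h) (Suc ((11 + 0) + b)) (conf i u) c"
    unfolding pass_def using assms(1) assms(4)[unfolded pass_def]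
    by (intro exec_loop_step) simp_all
  then show ?thesis
    by (rule exec_mono) simp
qed

lemma pass_token_nat:
  assumes "spells T i ([False, True, z] @ enc_nat p)" "length (h False True z) \<le> 5"
    and "exec (pass h) b (conf (i + 3 + int (length (enc_nat p))) (u @ h False True z @ enc_nat p)) c"
  shows "exec (pass h) (6 * (3 + length (enc_nat p)) + b) (conf i u) c"
proof -
  have sp: "spells T i [False, True, z]" "spells T (i + 3) (enc_nat p)"
    using assms(1) by (simp_all add: add.commute)
  have "exec (token h) (11 + 3 * length (enc_nat p)) (conf i u)
      (conf (i + 3 + int (length (enc_nat p))) ((u @ h False True z) @ enc_nat p))"
    by (rule exec_token[of i False True z h, OF sp(1) assms(2)]) (use exec_copy_nat[OF sp(2), of "u @ h False True z"] in simp)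
  then have "exec (pass h) (Suc ((11 + 3 * length (enc_nat p)) + b)) (conf i u) c"
    unfolding pass_def using assms(1) assms(3)[unfolded pass_def]
    by (intro exec_loop_step) simp_all
  then show ?thesis
    by (rule exec_mono) simp
qed

text \<open>The continuation of the loop is an assumption, so that the induction can treat the
  subformulas one after the other.\<close>

lemma pass_fm:
  assumes len: "\<And>x y z. length (h x y z) \<le> 5"
  shows "spells T i (enc_fm \<phi>) \<Longrightarrow>
    exec (pass h) b (conf (i + int (length (enc_fm \<phi>))) (u @ transduce h \<phi>)) c \<Longrightarrow>
    exec (pass h) (6 * length (enc_fm \<phi>) + b) (conf i u) c"
proof (induction \<phi> arbitrary: i u b)
  case (And \<phi> \<psi>)
  have "exec (pass h) (6 * length (enc_fm \<psi>) + b)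
      (conf (i + 3 + int (length (enc_fm \<phi>))) ((u @ h True False False) @ transduce h \<phi>)) c"
    using And.prems by (intro And.IH(2)) (simp_all add: algebra_simps)
  then have "exec (pass h) (6 * length (enc_fm \<phi>) + (6 * length (enc_fm \<psi>) + b))
      (conf (i + 3) (u @ h True False False)) c"
    using And.prems by (intro And.IH(1)) (simp_all add: algebra_simps)
  then have "exec (pass h) (18 + (6 * length (enc_fm \<phi>) + (6 * length (enc_fm \<psi>) + b))) (conf i u) c"
    using And.prems by (intro pass_token[of _ True False False] len) simp_all
  then show ?case by (simp add: algebra_simps)
next
  case (Or \<phi> \<psi>)
  have "exec (pass h) (6 * length (enc_fm \<psi>) + b)
      (conf (i + 3 + int (length (enc_fm \<phi>))) ((u @ h True False True) @ transduce h \<phi>)) c"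
    using Or.prems by (intro Or.IH(2)) (simp_all add: algebra_simps)
  then have "exec (pass h) (6 * length (enc_fm \<phi>) + (6 * length (enc_fm \<psi>) + b))
      (conf (i + 3) (u @ h True False True)) c"
    using Or.prems by (intro Or.IH(1)) (simp_all add: algebra_simps)
  then have "exec (pass h) (18 + (6 * length (enc_fm \<phi>) + (6 * length (enc_fm \<psi>) + b))) (conf i u) c"
    using Or.prems by (intro pass_token[of _ True False True] len) simp_all
  then show ?case by (simp add: algebra_simps)
next
  case (Box \<phi>)
  have "exec (pass h) (6 * length (enc_fm \<phi>) + b) (conf (i + 3) (u @ h True True False)) c"
    using Box.prems by (intro Box.IH) (simp_all add: algebra_simps)
  then have "exec (pass h) (18 + (6 * length (enc_fm \<phi>) + b)) (conf i u) c"
    using Box.prems by (intro pass_token[of _ True True False] len) simp_all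
  then show ?case by (simp add: algebra_simps)
next
  case (Dia \<phi>)
  have "exec (pass h) (6 * length (enc_fm \<phi>) + b) (conf (i + 3) (u @ h True True True)) c"
    using Dia.prems by (intro Dia.IH) (simp_all add: algebra_simps)
  then have "exec (pass h) (18 + (6 * length (enc_fm \<phi>) + b)) (conf i u) c"
    using Dia.prems by (intro pass_token[of _ True True True] len) simp_all
  then show ?case by (simp add: algebra_simps)
next
  case (Var p)
  then have "exec (pass h) (6 * (3 + length (enc_nat p)) + b) (conf i u) c"
    by (intro pass_token_nat[of _ False] len) (simp_all add: algebra_simps)
  then show ?case by simp
next
  case (NVar p)
  then have "exec (pass h) (6 * (3 + length (enc_nat p)) + b) (conf i u) c"
    by (intro pass_token_nat[of _ True] len) (simp_all add: algebra_simps)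
  then show ?case by simp
next
  case Bot
  then have "exec (pass h) (18 + b) (conf i u) c"
    by (intro pass_token[of _ False False False] len) simp_all
  then show ?case by simp
next
  case Top
  then have "exec (pass h) (18 + b) (conf i u) c"
    by (intro pass_token[of _ False False True] len) simp_all
  then show ?case by simp
qed

text \<open>The symbols of the word are nonblank, so the loop stops at the blank in cell
  \<open>-1\<close>, one move away from the start.\<close>

lemma exec_rewind:
  assumes "spells T 0 w" "T (-1) = 0"
  shows "exec rewind (2 * length w + 3) (conf (int (length w)) u) (conf 0 u)"
proof -
  let ?P = "\<lambda>ss. ss ! j \<noteq> 0"
  define c where "c m = conf (int (length w) - 1 - int m) u" for m
  have "exec (loop ?P (move (-1))) (Suc (length w * Suc 1)) (c 0) (c (length w))"
  proof (rule exec_loop_count, intro conjI)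
    fix m assume m: "m < length w"
    have "int (length w) - 1 - int m = 0 + int (length w - 1 - m)"
      using m by simp
    moreover have "T (0 + int (length w - 1 - m)) = bit_sym (w ! (length w - 1 - m))"
      using assms(1) m unfolding spells_iff by (auto simp del: of_nat_diff)
    ultimately show "heads (c m) ! j \<noteq> 0"
      unfolding c_def heads_conf by (metis bit_sym_pos less_numeral_extra(3))
    have "int (length w) - 1 - int m + -1 = int (length w) - 1 - int (Suc m)"
      by simp
    then show "exec (move (-1)) 1 (c m) (c (Suc m))"
      unfolding c_def using exec_move[of "-1"] by metis
  qed (simp add: c_def assms)
  then have loop: "exec (loop ?P (move (-1))) (Suc (length w * Suc 1))
      (conf (int (length w) + -1) u) (conf (-1) u)"
    by (simp add: c_def)
  have "exec rewind (1 + (Suc (length w * Suc 1) + 1)) (conf (int (length w)) u) (conf (-1 + 1) u)"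
    unfolding rewind_def by (rule exec_seq[OF exec_move exec_seq[OF loop exec_move]])
  then show ?thesis by (simp add: algebra_simps numeral_eq_Suc)
qed

lemma exec_passes:
  assumes T: "spells T 0 (enc_fm \<phi>)" "T (-1) = 0" "T (int (length (enc_fm \<phi>))) = 0"
    and len: "\<forall>x\<in>set xs. \<forall>a b c. length (snd x a b c) \<le> 5"
  shows "exec (passes xs) (\<Sum>x\<leftarrow>xs. length (fst x) + 8 * length (enc_fm \<phi>) + 4) (conf 0 u)
    (conf 0 (u @ concat (map (\<lambda>(v, h). v @ transduce h \<phi>) xs)))"
  using len
proof (induction xs arbitrary: u)
  case Nil
  then show ?case by (simp add: exec_skip)
next
  case (Cons x xs)
  obtain v h where x: "x = (v, h)" by fastforce
  let ?w = "enc_fm \<phi>" and ?u = "(u @ v) @ transduce h \<phi>"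
  have stop: "exec (pass h) 1 (conf (0 + int (length ?w)) ?u) (conf (int (length ?w)) ?u)"
    unfolding pass_def using exec_loop_stop[of "\<lambda>ss. ss ! j \<noteq> 0"] T by simp
  have p1: "exec (pass h) (6 * length ?w + 1) (conf 0 (u @ v)) (conf (int (length ?w)) ?u)"
    by (rule pass_fm[OF _ T(1) stop]) (use Cons.prems x in simp)
  have p2: "exec (passes xs) (\<Sum>x\<leftarrow>xs. length (fst x) + 8 * length ?w + 4) (conf 0 ?u)
      (conf 0 (?u @ concat (map (\<lambda>(v, h). v @ transduce h \<phi>) xs)))"
    by (rule Cons.IH) (use Cons.prems in simp)
  \<comment> \<open>With the final loop test, translating costs \<open>6 * length ?w + 1\<close>
    steps; rewinding costs \<open>2 * length ?w + 3\<close>. This is the summand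
    \<open>8 * length ?w + 4\<close>.\<close>
  have "exec (seq (emits v) (seq (pass h) (seq rewind (passes xs))))
      (length v + ((6 * length ?w + 1) + ((2 * length ?w + 3) +
        (\<Sum>x\<leftarrow>xs. length (fst x) + 8 * length ?w + 4)))) (conf 0 u)
      (conf 0 (?u @ concat (map (\<lambda>(v, h). v @ transduce h \<phi>) xs)))"
    by (rule exec_seq[OF exec_emits exec_seq[OF p1 exec_seq[OF exec_rewind[OF T(1,2)] p2]]])
  then show ?case
    by (simp add: x algebra_simps numeral_eq_Suc)
qed

end

section \<open>Polynomial time bound for the passes\<close>

section \<open>Polynomial-time computability\<close>

context two_tapes
begin

text \<open>The cells to the left of the word computed by a machine are arbitrary; a blank is needed there to
  find the way back after each pass.\<close>

definition mark_start :: tm where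
  "mark_start = seq (move (-1)) (io j n (\<lambda>s. (0, 1)) (\<lambda>s. (s, 0)))"

definition move_output :: "int \<Rightarrow> tm" where
  "move_output d = io j n (\<lambda>s. (s, 0)) (\<lambda>s. (s, d))"

text \<open>The passes leave the head behind the output word, whereas \<open>shows_word\<close>
  reads rightwards from the head.\<close>

definition rewind_output :: tm where
  "rewind_output = seq (move_output (-1))
     (seq (loop (\<lambda>ss. ss ! Suc j \<noteq> 0) (move_output (-1))) (move_output 1))"

lemma over_mark_start: "over mark_start"
  unfolding mark_start_def using n
  by (intro tm_over_seq over_move over_io) (auto simp: valid_act_fun_def)

lemma over_rewind_output: "over rewind_output"
  unfolding rewind_output_def move_output_def
  by (intro tm_over_seq tm_over_loop over_io) (auto simp: valid_act_fun_def)

lemma exec_move_output: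
  assumes "length J = j"
  shows "exec (move_output d) 1 (J @ [x, shifted y i]) (J @ [x, shifted y (i + d)])"
proof -
  have "act (x 0, 0) x = x" by (rule act_stay)
  moreover have "act (shifted y i 0, d) (shifted y i) = shifted y (i + d)"
    by (simp add: shifted_apply del: act.simps)
  ultimately show ?thesis
    using exec_io[OF assms, of "\<lambda>s. (s, 0)" "\<lambda>s. (s, d)" x "shifted y i"]
    by (simp add: move_output_def del: act.simps)
qed

lemma exec_mark_start:
  assumes "length J = j"
  shows "exec mark_start 2 (J @ [x, written u]) (J @ [x(-1 := 0), written u])"
proof -
  interpret two_tapes_run j n J x
    by standard (rule assms)
  have "act (0, 1) (shifted x (-1)) = x(-1 := 0)"
    by (auto simp: shifted_def fun_eq_iff)
  moreover have "act (written u 0, 0) (written u) = written u"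
    by (rule act_stay)
  ultimately have "exec (io j n (\<lambda>s. (0, 1)) (\<lambda>s. (s, 0))) 1 (conf (0 + -1) u) (J @ [x(-1 := 0), written u])"
    using exec_io[OF assms, of "\<lambda>s. (0, 1)" "\<lambda>s. (s, 0)" "shifted x (-1)" "written u"]
    by (simp add: config_def del: act.simps)
  from exec_seq[OF exec_move this] show ?thesis
    by (simp add: mark_start_def config_def numeral_2_eq_2)
qed

lemma exec_rewind_output:
  assumes "length J = j"
  shows "exec rewind_output (2 * length u + 3) (J @ [x, written u])
    (J @ [x, shifted (written u) (- int (length u))])"
proof -
  let ?P = "\<lambda>ss. ss ! Suc j \<noteq> 0"
  define c where "c m = J @ [x, shifted (written u) (- 1 - int m)]" for m
  have head: "heads (c m) ! Suc j = written u (- 1 - int m)" for m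
    using assms by (simp add: c_def heads_def nth_append shifted_apply)
  have "exec (loop ?P (move_output (-1))) (Suc (length u * Suc 1)) (c 0) (c (length u))"
  proof (rule exec_loop_count, intro conjI)
    fix m assume m: "m < length u"
    then show "heads (c m) ! Suc j \<noteq> 0"
      unfolding head by (simp add: written_def)
    have "- 1 - int m + -1 = - 1 - int (Suc m)" by simp
    then show "exec (move_output (-1)) 1 (c m) (c (Suc m))"
      unfolding c_def using exec_move_output[OF assms, of "-1"] by metis
  next
    show "\<not> heads (c (length u)) ! Suc j \<noteq> 0"
      unfolding head by (simp add: written_def)
  qed
  then have loop: "exec (loop ?P (move_output (-1))) (Suc (length u * Suc 1))
      (J @ [x, shifted (written u) (0 + -1)]) (J @ [x, shifted (written u) (- 1 - int (length u))])"
    by (simp add: c_def)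
  have "exec rewind_output (1 + (Suc (length u * Suc 1) + 1)) (J @ [x, shifted (written u) 0])
      (J @ [x, shifted (written u) (- 1 - int (length u) + 1)])"
    unfolding rewind_output_def
    by (rule exec_seq[OF exec_move_output[OF assms] exec_seq[OF loop exec_move_output[OF assms]]])
  moreover have "1 + (Suc (length u * Suc 1) + 1) = 2 * length u + 3" by simp
  moreover have "- 1 - int (length u) + 1 = - int (length u)" by simp
  ultimately show ?thesis by (metis shifted_0)
qed

end

lemma shows_word_written: "shows_word (shifted (written u) (- int (length u))) u"
  by (auto simp: shows_word_def shifted_def written_def)

lemma length_transduce:
  assumes "\<forall>a b c. length (h a b c) \<le> 5"
  shows "length (transduce h \<phi>) \<le> 5 * length (enc_fm \<phi>)"
proof (induction \<phi>)
  case (And \<phi> \<psi>)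
  have "length (h True False False) \<le> 5" using assms by blast
  with And show ?case by simp
next
  case (Or \<phi> \<psi>)
  have "length (h True False True) \<le> 5" using assms by blast
  with Or show ?case by simp
next
  case (Box \<phi>)
  have "length (h True True False) \<le> 5" using assms by blast
  with Box show ?case by simp
next
  case (Dia \<phi>)
  have "length (h True True True) \<le> 5" using assms by blast
  with Dia show ?case by simp
next
  case Bot
  have "length (h False False False) \<le> 5" using assms by blast
  then show ?case by simp
next
  case Top
  have "length (h False False True) \<le> 5" using assms by blast
  then show ?case by simp
next
  case (Var p)
  have "length (h False True False) \<le> 5" using assms by blast
  then show ?case by simp
next
  case (NVar p)
  have "length (h False True True) \<le> 5" using assms by blast
  then show ?case by simp
qed

lemma bounded_tapes_initial:
  assumes "wf_tm M"
  shows "bounded_tapes (ntapes M) (nsyms M) (length w) (snd (initial M w))"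
proof -
  have sub: "{x. input_tape w x \<noteq> 0} \<subseteq> int ` {..<length w}"
    by (auto simp: input_tape_def image_iff split: if_splits intro!: bexI[of _ "nat _"])
  then have "finite {x. input_tape w x \<noteq> 0}"
    by (rule finite_subset) simp
  moreover have "card {x. input_tape w x \<noteq> 0} \<le> card (int ` {..<length w})"
    by (rule card_mono[OF _ sub]) simp
  then have "card {x. input_tape w x \<noteq> 0} \<le> length w"
    by (simp add: card_image)
  moreover have "input_tape w x < nsyms M" for x
    using assms by (simp add: wf_tm_def input_tape_def bit_sym_def)
  ultimately show ?thesis
    using assms by (auto simp: wf_tm_def bounded_tapes_def initial_def blank_tape_def)
qed

text \<open>All letters of the word are nonblank. Together with \<open>bounded_tapes_run\<close>
  this bounds the output by input length plus running time.\<close>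

lemma shows_word_length:
  assumes "shows_word t w" "finite {x. t x \<noteq> 0}"
  shows "length w \<le> card {x. t x \<noteq> 0}"
proof -
  have "int ` {..<length w} \<subseteq> {x. t x \<noteq> 0}"
    using assms(1) by (auto simp: shows_word_def bit_sym_def)
  from card_mono[OF assms(2) this] show ?thesis
    by (simp add: card_image)
qed

text \<open>The given machine runs beside a spare tape; its output tape then becomes the input of
  the passes, and the spare tape receives the result.\<close>

lemma polytime_passes:
  fixes xs :: "(bool list \<times> (bool \<Rightarrow> bool \<Rightarrow> bool \<Rightarrow> bool list)) list"
  assumes "polytime (\<lambda>w. enc_fm (f w))"
    and len: "\<forall>x\<in>set xs. \<forall>a b c. length (snd x a b c) \<le> 5"
  shows "polytime (\<lambda>w. concat (map (\<lambda>(v, h). v @ transduce h (f w)) xs))"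
proof -
  obtain M p where wf: "wf_tm M" and
    run: "\<And>w. \<exists>m \<le> poly p (length w). \<exists>ts.
      (step M ^^ m) (initial M w) = (nstates M, ts) \<and> shows_word (last ts) (enc_fm (f w))"
    using assms(1) unfolding polytime_def by blast
  define j n where "j = ntapes M - 1" and "n = nsyms M"
  have M: "tm_over (Suc j) n M" and "3 \<le> n" and j: "ntapes M = Suc j"
    using wf by (auto simp: wf_tm_iff j_def n_def)
  interpret two_tapes j n by standard fact
  define M' where "M' = seq (add_tape M) (seq mark_start (seq (passes xs) rewind_output))"
  define e where "e = length xs"
  define c where "c = (\<Sum>x\<leftarrow>xs. length (fst x) + 4)"
  \<comment> \<open>For an intermediate word of length \<open>L\<close>, the passes cost
    \<open>c + 8 * (e * L)\<close>, the last rewinding at most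
    \<open>2 * (c + 5 * (e * L)) + 3\<close>, and marking the start \<open>2\<close>. The first
    machine takes at most \<open>p\<close> steps, and \<open>L\<close> is at most the input length
    plus that.\<close>
  define q where "q = p + [:5 + 3 * c:] + smult (18 * e) (monom 1 1 + p)"
  have "over M'"
    unfolding M'_def
    by (intro tm_over_seq tm_over_add_tape M over_mark_start over_passes over_rewind_output)
  moreover from this have "ntapes M' = Suc (Suc j)" "nsyms M' = n"
    by (simp_all add: tm_over_def)
  ultimately have wf': "wf_tm M'" and j': "ntapes M' = Suc (Suc j)"
    using \<open>3 \<le> n\<close> by (simp_all add: wf_tm_iff)
  have "\<exists>m \<le> poly q (length w). \<exists>ts. (step M' ^^ m) (initial M' w) = (nstates M', ts) \<and>
      shows_word (last ts) (concat (map (\<lambda>(v, h). v @ transduce h (f w)) xs))" for w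
  proof -
    let ?\<phi> = "f w" and ?out = "concat (map (\<lambda>(v, h). v @ transduce h (f w)) xs)"
    define L where "L = length (enc_fm ?\<phi>)"
    obtain m ts where m: "m \<le> poly p (length w)"
      and steps: "(step M ^^ m) (initial M w) = (nstates M, ts)"
      and word: "shows_word (last ts) (enc_fm ?\<phi>)"
      using run by blast
    define ts0 where "ts0 = snd (initial M w)"
    have init: "initial M w = (0, ts0)" "initial M' w = (0, ts0 @ [blank_tape])"
      by (simp_all add: ts0_def initial_def j j' replicate_append_same)
    have b0: "bounded_tapes (Suc j) n (length w) ts0"
      using bounded_tapes_initial[OF wf] by (simp add: ts0_def j n_def)
    have b: "bounded_tapes (Suc j) n (length w + m) ts"
      using bounded_tapes_run[OF M b0, of m 0] steps by (simp add: init)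
    define J x where "J = butlast ts" and "x = last ts"
    have J: "length J = j" and ts: "ts = J @ [x]"
      using b by (auto simp: J_def x_def bounded_tapes_def intro!: append_butlast_last_id[symmetric])
    have "L \<le> card {i. x i \<noteq> 0}" and "card {i. x i \<noteq> 0} \<le> length w + m"
      using b shows_word_length[OF word] by (auto simp: L_def ts bounded_tapes_def)
    then have L: "L \<le> length w + m" by simp
    have first: "exec (add_tape M) m (ts0 @ [blank_tape]) (J @ [x, written []])"
      using run_add_tape[OF M b0, of m 0 blank_tape] steps
      by (auto simp: exec_def init ts add_tape_def)
    define T where "T = x(-1 := 0)"
    interpret two_tapes_run j n J T
      by standard (rule J)
    have "spells T 0 (enc_fm ?\<phi>)" "T (-1) = 0" "T (int (length (enc_fm ?\<phi>))) = 0"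
      using word by (auto simp: spells_iff shows_word_def T_def ts)
    then have passes: "exec (passes xs) (\<Sum>x\<leftarrow>xs. length (fst x) + 8 * L + 4)
        (J @ [T, written []]) (J @ [T, written ?out])"
      using exec_passes[of ?\<phi> xs "[]"] len by (simp add: config_def L_def)
    have mark: "exec mark_start 2 (J @ [x, written []]) (J @ [T, written []])"
      unfolding T_def by (rule exec_mark_start[OF J])
    have bound: "m + (2 + (a + (2 * b + 3))) \<le> r"
      if "a = c + 8 * d" "b \<le> c + 5 * d" "m + (2 + ((c + 8 * d) + (2 * (c + 5 * d) + 3))) \<le> r"
      for a b d r :: nat
      using that by simp
    have "exec M' (m + (2 + ((\<Sum>x\<leftarrow>xs. length (fst x) + 8 * L + 4) + (2 * length ?out + 3))))
        (ts0 @ [blank_tape]) (J @ [T, shifted (written ?out) (- int (length ?out))])"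
      unfolding M'_def
      by (rule exec_seq[OF first exec_seq[OF mark exec_seq[OF passes exec_rewind_output[OF J]]]])
    moreover have "(\<Sum>x\<leftarrow>xs. length (fst x) + 8 * L + 4) = c + 8 * (e * L)"
      unfolding c_def e_def by (induction xs) (simp_all add: algebra_simps)
    moreover have "length ?out \<le> c + 5 * (e * L)"
      unfolding c_def e_def using len
    proof (induction xs)
      case (Cons y ys)
      then have "length (transduce (snd y) ?\<phi>) \<le> 5 * L"
        unfolding L_def by (intro length_transduce) simp
      with Cons show ?case by (simp add: split_beta algebra_simps)
    qed simp
    moreover have "m + (2 + ((c + 8 * (e * L)) + (2 * (c + 5 * (e * L)) + 3))) \<le> poly q (length w)"
    proof -
      have "18 * (e * L) \<le> 18 * (e * (length w + poly p (length w)))"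
        using L m by (intro mult_left_mono) auto
      with m show ?thesis
        by (simp add: q_def poly_monom algebra_simps)
    qed
    ultimately have "exec M' (poly q (length w)) (ts0 @ [blank_tape])
        (J @ [T, shifted (written ?out) (- int (length ?out))])"
      by (elim exec_mono) (rule bound)
    then show ?thesis
      using shows_word_written[of ?out] unfolding exec_def init by auto
  qed
  with wf' show ?thesis
    unfolding polytime_def by blast
qed

section \<open>The reduction as a list of passes\<close>

section \<open>The reduction is computable in polynomial time\<close>

text \<open>The codes of dual symbols differ exactly in the third bit, so negation flips it. The
  pair \<open>True, True\<close> inserts a lowest bit \<open>1\<close>, turning the index
  \<open>p\<close> into \<open>2 * p + 1\<close>.\<close>

definition neg_shift_token :: "bool \<Rightarrow> bool \<Rightarrow> bool \<Rightarrow> bool list" where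
  "neg_shift_token a b c = [a, b, \<not> c] @ (if \<not> a \<and> b then [True, True] else [])"

definition lits_token :: "bool \<Rightarrow> bool \<Rightarrow> bool \<Rightarrow> bool list" where
  "lits_token a b c =
     (if a then if b then [] else [True, False, False]
      else if b then [False, True, False, True, True] else [False, False, True])"

lemma enc_nat_shift: "enc_nat (Suc (2 * p)) = True # True # enc_nat p"
  by (simp add: enc_nat_pos)

lemma enc_neg_shift: "enc_fm (neg (shift \<phi>)) = transduce neg_shift_token \<phi>"
  by (induction \<phi>) (simp_all add: shift_def neg_shift_token_def enc_nat_shift)

lemma enc_lits: "enc_fm (lits \<phi>) = transduce lits_token \<phi>"
  by (induction \<phi>) (simp_all add: lits_token_def enc_nat_shift)

text \<open>Each translated copy of the formula takes its own pass. Symbols between two copies go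
  into the prefix of the later one, such as \<open>NVar 0\<close>, which closes the conjunction
  begun before the first pass.\<close>

definition reduction_passes ::
  "modal_logic \<Rightarrow> (bool list \<times> (bool \<Rightarrow> bool \<Rightarrow> bool \<Rightarrow> bool list)) list" where
  "reduction_passes l =
     (let c = [True, False, False] @ enc_fm (Var 0); box = [True, True, False] in
      ([True, False, True] @ [True, False, False], neg_shift_token) #
      (if AxD \<in> l \<or> AxT \<in> l
       then [(enc_fm (NVar 0) @ [True, False, False] @ c, lits_token),
             ([True, False, False] @ box @ c, lits_token),
             (box @ box @ c, lits_token)]
       else [(enc_fm (NVar 0) @ [True, False, False] @ enc_fm (Box Bot) @ c, lits_token)]))"

lemma enc_reduction:
  "enc_fm (reduction l \<phi>) = concat (map (\<lambda>(v, h). v @ transduce h \<phi>) (reduction_passes l))"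
  by (simp add: reduction_def char_fm_def all_true_def reduction_passes_def Let_def
      enc_neg_shift enc_lits)

text \<open>Stated for a composition with \<open>f\<close>, since hardness concerns functions from
  words to formulas; the passes thus only ever meet codes of formulas.\<close>

lemma polytime_reduction:
  assumes "polytime (\<lambda>w. enc_fm (f w))"
  shows "polytime (\<lambda>w. enc_fm (reduction l (f w)))"
  unfolding enc_reduction
  by (rule polytime_passes[OF assms])
    (auto simp: reduction_passes_def Let_def neg_shift_token_def lits_token_def)

theorem theorem17:
  fixes l :: modal_logic and C :: "bool list set set"
  assumes "nontrivial_completeness_problem l"
    and "hard_for C (provability_problem l)"
  shows "hard_for C (completeness_problem l)"
  unfolding hard_for_def
proof
  fix A assume "A \<in> C"
  with assms(2) obtain f where "polytime (\<lambda>w. enc_fm (f w))"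
    and "\<forall>w. w \<in> A \<longleftrightarrow> f w \<in> provability_problem l"
    unfolding hard_for_def polytime_reducible_def by blast
  then have "polytime (\<lambda>w. enc_fm (reduction l (f w))) \<and>
      (\<forall>w. w \<in> A \<longleftrightarrow> reduction l (f w) \<in> completeness_problem l)"
    using polytime_reduction reduction_correct[OF assms(1)]
    by (simp add: provability_problem_def completeness_problem_def)
  then show "polytime_reducible A (completeness_problem l)"
    unfolding polytime_reducible_def by (rule exI[of _ "\<lambda>w. reduction l (f w)"])
qed

end
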